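(* Let $X$, $\mu$, $\sigma$, $\hat\mu$, $c_{-1}$, $\mathcal{P}_h$, $Y_n$, $R_n$, $R_n^{(1)}$, $R_n^{(2)}$ be as described in the context, and suppose that (A1)–(A6) of the context hold. Let $p$ be a real number with $$1 \le p \le \Big(-\tfrac{p^*}{2\deg^-(\mu)}\Big) \wedge \tfrac{p^*}{2m_1},$$ where $p^*$ comes from (A3) and $m_1$ from (A5). Then there exists a constant $C>0$, independent of the step size $h$, such that $$\mathbb{E}\Big[\sup_{n=0,\dots,M}|X_{t_n}-Y_n|^{2p}\Big]\le C\Big(\tfrac{1}{h^{2p}}\sup_{n=1,\dots,M}\mathbb{E}\big[|R_n^{(1)}|^{2p}\big]+\tfrac{1}{h^{p}}\sup_{n=1,\dots,M}\mathbb{E}\big[|R_n^{(2)}|^{2p}\big]\Big).$$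
   Context: Notation: $a\wedge b=\min\{a,b\}$, $a\vee b=\max\{a,b\}$; $T\in(0,\infty)$; $W=(W_t)_{t\ge0}$ is a standard Brownian motion on a complete filtered probability space $(\Omega,\mathcal{F},(\mathcal{F}_t)_{t\ge0},\mathbb{P})$ satisfying the usual conditions. Fractional Laurent polynomial (FLP): a function $q:(0,\infty)\to\mathbb{R}$ of the form $q(x)=\sum_{n=e_1}^{e_2}a_nx^{s_n}$ with integers $e_1\le e_2$, $a_n\in\mathbb{R}$, and pairwise distinct exponents $s_n\in\mathbb{R}$. For $q\not\equiv0$, $\deg^-(q)=\min\{s_n: a_n\ne0\}$, $\deg^+(q)=\max\{s_n:a_n\neq 0\}$, and $\mathrm{coeff}^{-}(q)$, $\mathrm{coeff}^{+}(q)$ are the coefficients $a_n$ belonging to these exponents. Original and transformed SDE: $d\mathbb{X}_t=f(\mathbb{X}_t)\,dt+g(\mathbb{X}_t)\,dW_t$, $t\ge0$, with deterministic $\mathbb{X}_0>0$, where $f,g:(0,\infty)\to\mathbb{R}$ are continuously differentiable and $g>0$. For constants $a\in(0,\infty)$, $b\in\mathbb{R}$, $\sigma\ne0$, the Lamperti transformation $\mathbb{L}(x)=\sigma\int_a^x\frac{1}{g(u)}\,du+b$ is assumed to be a bijection from $(0,\infty)$ onto $(0,\infty)$. Then $X_t=\mathbb{L}(\mathbb{X}_t)$ satisfies $dX_t=\mu(X_t)\,dt+\sigma\,dW_t$, $X_0=\mathbb{L}(\mathbb{X}_0)>0$, with $\mu(x)=\sigma\big(\frac{f(\mathbb{L}^{-1}(x))}{g(\mathbb{L}^{-1}(x))}-\frac12g'(\mathbb{L}^{-1}(x))\big)$.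 Throughout, $\mu$ is assumed to be an FLP. Scheme: $M\in\mathbb{N}$, $h=T/M\in(0,1]$, $t_n=nh$, $\Delta W_n=W_{t_{n+1}}-W_{t_n}$, $c_{-1}>0$ is a constant, $\hat\mu(x)=\mu(x)-c_{-1}x^{-1}$, $\mathcal{P}_h:(0,\infty)\to(0,\infty)$ is a map (depending on $h$), $Y_0=X_0$, and $Y_{n+1}$ is the unique positive solution of $$Y_{n+1}=\mathcal{P}_h(Y_n)+c_{-1}hY_{n+1}^{-1}+\hat\mu(\mathcal{P}_h(Y_n))h+\sigma\Delta W_n,\quad n=0,\dots,M-1.$$ Remainder: for $n=0,\dots,M-1$, $$R_{n+1}=X_{t_n}-\mathcal{P}_h(X_{t_n})+\int_{t_n}^{t_{n+1}}\mu(X_s)\,ds-c_{-1}hX_{t_{n+1}}^{-1}-\hat\mu(\mathcal{P}_h(X_{t_n}))h,$$ and $R_{n+1}=R_{n+1}^{(1)}+R_{n+1}^{(2)}$ is a decomposition into $\mathcal{F}_{t_{n+1}}$-measurable random variables such that $R^{(2)}_{n+1}$ is integrable and $\mathbb{E}[R_{n+1}^{(2)}\mid\mathcal{F}_{t_n}]=0$ for all $n=0,\dots,M-1$. Assumptions: (A1) The original SDE has a unique strong solution with $\mathbb{P}(\mathbb{X}_t\in(0,\infty),\ t\ge0)=1$. (A2) $\mu$ is continuously differentiable and there is $L_0>0$ with $(\mu(x)-\mu(y))(x-y)\le L_0|x-y|^2$ for all $x,y>0$. (A3) For some $p^*\in(2,\infty]$: $\sup_{t\in[0,T]}\mathbb{E}[|X_t|^{-p}]<\infty$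 for all (finite) $0<p\le p^*$. (A4) There is $L>0$ with $(\hat\mu(x)-\hat\mu(y))(x-y)\le L|x-y|^2$ for all $x,y>0$. (A5) $|\mathcal{P}_h(x)-\mathcal{P}_h(y)|\le|x-y|$ for all $x,y>0$, and there are constants $m_1,m_2\ge0$ and $C>0$ independent of $h$ such that $|\mathcal{P}_h(x)-x|\le Ch^2(1+|x|^{-m_1}+|x|^{m_2})$ for all $x>0$. (A6) There is $C>0$ independent of $h$ such that for all $x,y>0$: $|\hat\mu(\mathcal{P}_h(x))|\le Ch^{-1/2}\vee C|x|$ and $|\hat\mu(\mathcal{P}_h(x))-\hat\mu(\mathcal{P}_h(y))|\le Ch^{-1/2}|x-y|$. Conventions: $p^*/(2m_1)=+\infty$ if $m_1=0$; if $p^*=+\infty$ the upper bound on $p$ is $+\infty$. *)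

theory Defs
  imports "HOL-Probability.Probability"
begin

section \<open>Fractional Laurent polynomials\<close>

definition FLP_rep :: "(real \<Rightarrow> real) \<Rightarrow> int \<Rightarrow> int \<Rightarrow> (int \<Rightarrow> real) \<Rightarrow> (int \<Rightarrow> real) \<Rightarrow> bool" where
  "FLP_rep q e1 e2 a s \<longleftrightarrow>
     e1 \<le> e2 \<and> inj_on s {e1..e2} \<and> (\<forall>x>0. q x = (\<Sum>n=e1..e2. a n * x powr s n))"

definition is_FLP :: "(real \<Rightarrow> real) \<Rightarrow> bool" where
  "is_FLP q \<longleftrightarrow> (\<exists>e1 e2 a s. FLP_rep q e1 e2 a s)"

text \<open>For an FLP that does not vanish identically on the positive half-line, the lowest exponent
  does not depend on the representation (lemma \<open>deg_minus_eq\<close> below). The value is unspecified for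
  the zero function.\<close>

definition deg_minus :: "(real \<Rightarrow> real) \<Rightarrow> real" where
  "deg_minus q = (THE d. \<exists>e1 e2 a s. FLP_rep q e1 e2 a s \<and> (\<exists>n\<in>{e1..e2}. a n \<noteq> 0) \<and>
                          d = Min {s n | n. n \<in> {e1..e2} \<and> a n \<noteq> 0})"

lemma powr_at_right_0:
  fixes r :: real
  assumes "0 < r"
  shows "((\<lambda>x. x powr r) \<longlongrightarrow> 0) (at_right (0::real))"
proof -
  have "\<forall>\<^sub>F x in at_right 0. (0::real) \<le> x"
    by (rule eventually_at_rightI[of 0 1]) auto
  then have "((\<lambda>x. x powr r) \<longlongrightarrow> 0 powr r) (at_right (0::real))"
    using assms by (intro tendsto_powr' tendsto_ident_at tendsto_const) auto
  then show ?thesis by simp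
qed

lemma FLP_rep_limit:
  assumes rep: "FLP_rep q e1 e2 a s" and ne: "\<exists>n\<in>{e1..e2}. a n \<noteq> 0"
    and d: "d = Min {s n | n. n \<in> {e1..e2} \<and> a n \<noteq> 0}"
  shows "\<exists>c. c \<noteq> 0 \<and> ((\<lambda>x. q x * x powr (- d)) \<longlongrightarrow> c) (at_right 0)"
proof -
  let ?S = "{s n | n. n \<in> {e1..e2} \<and> a n \<noteq> 0}"
  have fin: "finite ?S"
    by (rule finite_subset[of _ "s ` {e1..e2}"]) auto
  have "?S \<noteq> {}" using ne by blast
  from Min_in[OF fin this] d obtain k where k: "k \<in> {e1..e2}" "a k \<noteq> 0" "d = s k" by blast
  have low: "d \<le> s n" if "n \<in> {e1..e2}" "a n \<noteq> 0" for n
    using Min_le[OF fin, of "s n"] d that by blast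
  have lim: "((\<lambda>x. a n * x powr (s n - d)) \<longlongrightarrow> (if n = k then a k else 0)) (at_right 0)"
    if n: "n \<in> {e1..e2}" for n
  proof (cases "n = k")
    case True
    have "\<forall>\<^sub>F x in at_right (0::real). a n * x powr (s n - d) = a k"
      by (rule eventually_at_rightI[of 0 1]) (use True k(3) in simp_all)
    then show ?thesis using True by (simp add: tendsto_eventually)
  next
    case False
    show ?thesis
    proof (cases "a n = 0")
      case False
      have "s n \<noteq> s k" using rep n k(1) \<open>n \<noteq> k\<close> by (auto simp: FLP_rep_def inj_on_def)
      then have "0 < s n - d" using low[OF n False] k(3) by simp
      then have "((\<lambda>x. x powr (s n - d)) \<longlongrightarrow> 0) (at_right 0)"
        by (rule powr_at_right_0)
      from tendsto_mult_left[OF this, of "a n"] \<open>n \<noteq> k\<close> show ?thesis by simp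
    qed (use \<open>n \<noteq> k\<close> in simp)
  qed
  have "((\<lambda>x. \<Sum>n=e1..e2. a n * x powr (s n - d)) \<longlongrightarrow> (\<Sum>n=e1..e2. if n = k then a k else 0)) (at_right 0)"
    by (rule tendsto_sum) (rule lim)
  moreover have "(\<Sum>n=e1..e2. if n = k then a k else 0) = a k"
    using k(1) by simp
  moreover have "\<forall>\<^sub>F x in at_right 0. (\<Sum>n=e1..e2. a n * x powr (s n - d)) = q x * x powr (- d)"
  proof (rule eventually_at_rightI[of 0 1])
    fix x :: real assume "x \<in> {0<..<1}"
    then have q: "q x = (\<Sum>n=e1..e2. a n * x powr s n)"
      using rep by (simp add: FLP_rep_def)
    have "a n * x powr (s n - d) = a n * x powr s n * x powr (- d)" for n
      by (metis diff_conv_add_uminus mult.assoc powr_add)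
    then show "(\<Sum>n=e1..e2. a n * x powr (s n - d)) = q x * x powr (- d)"
      by (simp only: q sum_distrib_right)
  qed simp
  ultimately have "((\<lambda>x. q x * x powr (- d)) \<longlongrightarrow> a k) (at_right 0)"
    by (simp only: tendsto_cong)
  then show ?thesis using k(2) by blast
qed

lemma deg_minus_eq:
  assumes rep: "FLP_rep q e1 e2 a s" and ne: "\<exists>n\<in>{e1..e2}. a n \<noteq> 0"
  shows "deg_minus q = Min {s n | n. n \<in> {e1..e2} \<and> a n \<noteq> 0}"
proof -
  have no: False if d: "d < d'" and "c \<noteq> 0"
    and c: "((\<lambda>x. q x * x powr (- d)) \<longlongrightarrow> c) (at_right 0)"
    and c': "((\<lambda>x. q x * x powr (- d')) \<longlongrightarrow> c') (at_right 0)" for d d' c c'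
  proof -
    have "((\<lambda>x. x powr (d' - d)) \<longlongrightarrow> 0) (at_right (0::real))"
      by (rule powr_at_right_0) (use d in simp)
    from tendsto_mult[OF c' this]
    have "((\<lambda>x. q x * x powr (- d') * x powr (d' - d)) \<longlongrightarrow> 0) (at_right 0)" by simp
    moreover have "q x * x powr (- d') * x powr (d' - d) = q x * x powr (- d)" for x
      by (simp add: mult.assoc powr_add[symmetric])
    ultimately have "((\<lambda>x. q x * x powr (- d)) \<longlongrightarrow> 0) (at_right 0)" by simp
    with c have "c = 0" using tendsto_unique trivial_limit_at_right_real by blast
    with \<open>c \<noteq> 0\<close> show False by simp
  qed
  show ?thesis
    unfolding deg_minus_def
  proof (rule the_equality)
    fix d assume "\<exists>e1 e2 a s. FLP_rep q e1 e2 a s \<and> (\<exists>n\<in>{e1..e2}. a n \<noteq> 0) \<and>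
                    d = Min {s n | n. n \<in> {e1..e2} \<and> a n \<noteq> 0}"
    then obtain e1' e2' a' s' where "FLP_rep q e1' e2' a' s'" "\<exists>n\<in>{e1'..e2'}. a' n \<noteq> 0"
      "d = Min {s' n | n. n \<in> {e1'..e2'} \<and> a' n \<noteq> 0}" by blast
    from FLP_rep_limit[OF this] obtain c
      where c: "c \<noteq> 0" "((\<lambda>x. q x * x powr (- d)) \<longlongrightarrow> c) (at_right 0)" by blast
    define d' where "d' = Min {s n | n. n \<in> {e1..e2} \<and> a n \<noteq> 0}"
    from FLP_rep_limit[OF rep ne d'_def] obtain c'
      where c': "c' \<noteq> 0" "((\<lambda>x. q x * x powr (- d')) \<longlongrightarrow> c') (at_right 0)" by blast
    have "d = d'"
      using no[OF _ c c'(2)] no[OF _ c' c(2)] by (cases d d' rule: linorder_cases) simp_all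
    then show "d = Min {s n | n. n \<in> {e1..e2} \<and> a n \<noteq> 0}"
      by (simp only: d'_def)
  qed (intro exI conjI, rule rep, rule ne, rule refl)
qed

section \<open>Filtrations, Brownian motion, stochastic integration\<close>

text \<open>Time runs over \<open>t \<ge> 0\<close>; the values of filtrations and processes at negative times are
  irrelevant.\<close>

definition usual_filtration :: "'a measure \<Rightarrow> (real \<Rightarrow> 'a measure) \<Rightarrow> bool" where
  "usual_filtration M F \<longleftrightarrow>
     prob_space M \<and> complete_measure M \<and>
     (\<forall>t\<ge>0. subalgebra M (F t)) \<and>
     (\<forall>s t. 0 \<le> s \<longrightarrow> s \<le> t \<longrightarrow> sets (F s) \<subseteq> sets (F t)) \<and>
     null_sets M \<subseteq> sets (F 0) \<and>
     (\<forall>t\<ge>0. sets (F t) = (\<Inter>s\<in>{t<..}. sets (F s)))"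

definition adapted :: "(real \<Rightarrow> 'a measure) \<Rightarrow> (real \<Rightarrow> 'a \<Rightarrow> real) \<Rightarrow> bool" where
  "adapted F X \<longleftrightarrow> (\<forall>t\<ge>0. X t \<in> borel_measurable (F t))"

definition brownian_motion :: "'a measure \<Rightarrow> (real \<Rightarrow> 'a measure) \<Rightarrow> (real \<Rightarrow> 'a \<Rightarrow> real) \<Rightarrow> bool" where
  "brownian_motion M F W \<longleftrightarrow>
     adapted F W \<and>
     (AE \<omega> in M. W 0 \<omega> = 0) \<and>
     (AE \<omega> in M. continuous_on {0..} (\<lambda>t. W t \<omega>)) \<and>
     (\<forall>s t. 0 \<le> s \<longrightarrow> s < t \<longrightarrow>
        prob_space.indep_set M (sets (F s))
          {(\<lambda>\<omega>. W t \<omega> - W s \<omega>) -` B \<inter> space M | B. B \<in> sets borel} \<and>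
        distributed M lborel (\<lambda>\<omega>. W t \<omega> - W s \<omega>) (normal_density 0 (sqrt (t - s))))"

text \<open>A simple process is \<open>\<Sum>i<k. \<xi> i \<cdot> 1_(s i, s (i+1)]\<close> with bounded, \<open>F (s i)\<close>-measurable \<open>\<xi> i\<close>.\<close>

definition simple_process ::
  "'a measure \<Rightarrow> (real \<Rightarrow> 'a measure) \<Rightarrow> nat \<Rightarrow> (nat \<Rightarrow> real) \<Rightarrow> (nat \<Rightarrow> 'a \<Rightarrow> real) \<Rightarrow> bool" where
  "simple_process M F k s \<xi> \<longleftrightarrow>
     0 \<le> s 0 \<and>
     (\<forall>i<k. s i \<le> s (Suc i) \<and> \<xi> i \<in> borel_measurable (F (s i)) \<and>
            (\<exists>B. \<forall>\<omega>\<in>space M. \<bar>\<xi> i \<omega>\<bar> \<le> B))"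

definition simple_value ::
  "nat \<Rightarrow> (nat \<Rightarrow> real) \<Rightarrow> (nat \<Rightarrow> 'a \<Rightarrow> real) \<Rightarrow> real \<Rightarrow> 'a \<Rightarrow> real" where
  "simple_value k s \<xi> t \<omega> = (\<Sum>i<k. \<xi> i \<omega> * indicator {s i<..s (Suc i)} t)"

definition simple_ito ::
  "(real \<Rightarrow> 'a \<Rightarrow> real) \<Rightarrow> nat \<Rightarrow> (nat \<Rightarrow> real) \<Rightarrow> (nat \<Rightarrow> 'a \<Rightarrow> real) \<Rightarrow> real \<Rightarrow> 'a \<Rightarrow> real" where
  "simple_ito W k s \<xi> t \<omega> =
     (\<Sum>i<k. \<xi> i \<omega> * (W (min (s (Suc i)) t) \<omega> - W (min (s i) t) \<omega>))"

definition tends_in_prob :: "'a measure \<Rightarrow> (nat \<Rightarrow> 'a \<Rightarrow> real) \<Rightarrow> ('a \<Rightarrow> real) \<Rightarrow> bool" where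
  "tends_in_prob M Z z \<longleftrightarrow>
     (\<forall>\<epsilon>>0. (\<lambda>n. measure M {\<omega> \<in> space M. \<epsilon> < \<bar>Z n \<omega> - z \<omega>\<bar>}) \<longlonglongrightarrow> 0)"

text \<open>\<open>J\<close> is (a version of) the Ito integral of \<open>H\<close> against \<open>W\<close> over \<open>[0,t]\<close>: there are simple
  processes converging to \<open>H\<close> in \<open>L\<^sup>2[0,t]\<close> in probability whose elementary integrals converge to
  \<open>J\<close> in probability. Integrands are adapted with almost surely continuous paths, so that they are
  pathwise square integrable on compact intervals; since \<open>M\<close> is complete, all events involved are
  measurable even though nothing is assumed on the exceptional null set.\<close>

definition has_ito_integral ::
  "'a measure \<Rightarrow> (real \<Rightarrow> 'a measure) \<Rightarrow> (real \<Rightarrow> 'a \<Rightarrow> real) \<Rightarrow> (real \<Rightarrow> 'a \<Rightarrow> real) \<Rightarrow> real \<Rightarrow>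
     ('a \<Rightarrow> real) \<Rightarrow> bool" where
  "has_ito_integral M F W H t J \<longleftrightarrow>
     adapted F H \<and> (AE \<omega> in M. continuous_on {0..} (\<lambda>u. H u \<omega>)) \<and>
     J \<in> borel_measurable M \<and>
     (\<exists>k s \<xi>. (\<forall>n. simple_process M F (k n) (s n) (\<xi> n)) \<and>
        tends_in_prob M
          (\<lambda>n \<omega>. LBINT u:{0..t}. (simple_value (k n) (s n) (\<xi> n) u \<omega> - H u \<omega>)\<^sup>2) (\<lambda>\<omega>. 0) \<and>
        tends_in_prob M (\<lambda>n. simple_ito W (k n) (s n) (\<xi> n) t) J)"

text \<open>Solutions of \<open>dX = f(X) dt + g(X) dW\<close>, \<open>X 0 = x0\<close>, with state space \<open>(0,\<infinity>)\<close>, on which alone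
  the coefficients are meaningful. The filtered probability space and the Brownian motion are
  given in advance, and solutions are adapted to the given filtration.\<close>

definition strong_solution ::
  "'a measure \<Rightarrow> (real \<Rightarrow> 'a measure) \<Rightarrow> (real \<Rightarrow> 'a \<Rightarrow> real) \<Rightarrow> (real \<Rightarrow> real) \<Rightarrow> (real \<Rightarrow> real) \<Rightarrow>
     real \<Rightarrow> (real \<Rightarrow> 'a \<Rightarrow> real) \<Rightarrow> bool" where
  "strong_solution M F W f g x0 X \<longleftrightarrow>
     adapted F X \<and>
     (AE \<omega> in M. continuous_on {0..} (\<lambda>t. X t \<omega>)) \<and>
     (AE \<omega> in M. \<forall>t\<ge>0. 0 < X t \<omega>) \<and>
     (AE \<omega> in M. X 0 \<omega> = x0) \<and>
     (\<forall>t\<ge>0. has_ito_integral M F W (\<lambda>u \<omega>. g (X u \<omega>)) t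
               (\<lambda>\<omega>. X t \<omega> - x0 - (LBINT u=0..t. f (X u \<omega>))))"

definition unique_strong_solution ::
  "'a measure \<Rightarrow> (real \<Rightarrow> 'a measure) \<Rightarrow> (real \<Rightarrow> 'a \<Rightarrow> real) \<Rightarrow> (real \<Rightarrow> real) \<Rightarrow> (real \<Rightarrow> real) \<Rightarrow>
     real \<Rightarrow> (real \<Rightarrow> 'a \<Rightarrow> real) \<Rightarrow> bool" where
  "unique_strong_solution M F W f g x0 X \<longleftrightarrow>
     strong_solution M F W f g x0 X \<and>
     (\<forall>X'. strong_solution M F W f g x0 X' \<longrightarrow> (AE \<omega> in M. \<forall>t\<ge>0. X' t \<omega> = X t \<omega>))"

section \<open>Lamperti transformation\<close>

definition lamperti :: "real \<Rightarrow> real \<Rightarrow> real \<Rightarrow> (real \<Rightarrow> real) \<Rightarrow> real \<Rightarrow> real" where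
  "lamperti a b \<sigma> g x = \<sigma> * (LBINT u=a..x. 1 / g u) + b"

definition lamperti_inv :: "real \<Rightarrow> real \<Rightarrow> real \<Rightarrow> (real \<Rightarrow> real) \<Rightarrow> real \<Rightarrow> real" where
  "lamperti_inv a b \<sigma> g = inv_into {0<..} (lamperti a b \<sigma> g)"

definition lamperti_drift ::
  "real \<Rightarrow> real \<Rightarrow> real \<Rightarrow> (real \<Rightarrow> real) \<Rightarrow> (real \<Rightarrow> real) \<Rightarrow> real \<Rightarrow> real" where
  "lamperti_drift a b \<sigma> f g x =
     (let y = lamperti_inv a b \<sigma> g x in \<sigma> * (f y / g y - 1 / 2 * deriv g y))"

section \<open>The scheme and its remainder\<close>

definition mu_hat :: "(real \<Rightarrow> real) \<Rightarrow> real \<Rightarrow> real \<Rightarrow> real" where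
  "mu_hat \<mu> c x = \<mu> x - c * inverse x"

text \<open>\<open>N\<close> is the number of steps, \<open>h = T / N\<close> the step size.\<close>

definition admissible_steps :: "real \<Rightarrow> nat set" where
  "admissible_steps T = {N. 1 \<le> N \<and> T / real N \<le> 1}"

definition step_sizes :: "real \<Rightarrow> real set" where
  "step_sizes T = (\<lambda>N. T / real N) ` admissible_steps T"

primrec scheme ::
  "(real \<Rightarrow> real) \<Rightarrow> real \<Rightarrow> real \<Rightarrow> (real \<Rightarrow> 'a \<Rightarrow> real) \<Rightarrow> (real \<Rightarrow> real) \<Rightarrow> real \<Rightarrow> real \<Rightarrow>
     nat \<Rightarrow> 'a \<Rightarrow> real" where
  "scheme \<mu> c \<sigma> W Ph h y0 0 \<omega> = y0"
| "scheme \<mu> c \<sigma> W Ph h y0 (Suc n) \<omega> =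
     (THE y. 0 < y \<and>
        y = Ph (scheme \<mu> c \<sigma> W Ph h y0 n \<omega>) + c * h * inverse y
            + mu_hat \<mu> c (Ph (scheme \<mu> c \<sigma> W Ph h y0 n \<omega>)) * h
            + \<sigma> * (W (real (Suc n) * h) \<omega> - W (real n * h) \<omega>))"

text \<open>\<open>remainder \<dots> n\<close> belongs to the step from \<open>n h\<close> to \<open>(n+1) h\<close>, i.e. it is \<open>R\<^sub>n\<^sub>+\<^sub>1\<close>.\<close>

definition remainder ::
  "(real \<Rightarrow> real) \<Rightarrow> real \<Rightarrow> (real \<Rightarrow> 'a \<Rightarrow> real) \<Rightarrow> (real \<Rightarrow> real) \<Rightarrow> real \<Rightarrow> nat \<Rightarrow> 'a \<Rightarrow> real" where
  "remainder \<mu> c X Ph h n \<omega> =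
     X (real n * h) \<omega> - Ph (X (real n * h) \<omega>)
     + (LBINT u=real n * h..real (Suc n) * h. \<mu> (X u \<omega>))
     - c * h * inverse (X (real (Suc n) * h) \<omega>)
     - mu_hat \<mu> c (Ph (X (real n * h) \<omega>)) * h"

definition remainder_decomposition ::
  "'a measure \<Rightarrow> (real \<Rightarrow> 'a measure) \<Rightarrow> (nat \<Rightarrow> 'a \<Rightarrow> real) \<Rightarrow> real \<Rightarrow> nat \<Rightarrow>
     (nat \<Rightarrow> 'a \<Rightarrow> real) \<Rightarrow> (nat \<Rightarrow> 'a \<Rightarrow> real) \<Rightarrow> bool" where
  "remainder_decomposition M F R h N R1 R2 \<longleftrightarrow>
     (\<forall>n<N. R1 (Suc n) \<in> borel_measurable (F (real (Suc n) * h)) \<and>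
            R2 (Suc n) \<in> borel_measurable (F (real (Suc n) * h)) \<and>
            (AE \<omega> in M. R n \<omega> = R1 (Suc n) \<omega> + R2 (Suc n) \<omega>) \<and>
            integrable M (R2 (Suc n)) \<and>
            (AE \<omega> in M. real_cond_exp M (F (real n * h)) (R2 (Suc n)) \<omega> = 0))"

text \<open>The upper bound for the exponent, \<open>(-p\<^sup>*/(2d)) \<and> (p\<^sup>*/(2m))\<close>, with the conventions
  \<open>p\<^sup>*/(2m) = \<infinity>\<close> for \<open>m = 0\<close>, and \<open>\<infinity>\<close> for the whole bound if \<open>p\<^sup>* = \<infinity>\<close>.\<close>

definition exponent_bound :: "ereal \<Rightarrow> real \<Rightarrow> real \<Rightarrow> ereal" where
  "exponent_bound pstar d m =
     (if pstar = \<infinity> then \<infinity>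
      else min (- (pstar / ereal (2 * d))) (if m = 0 then \<infinity> else pstar / ereal (2 * m)))"

end

theory Submission
  imports Defs
begin

text \<open>Write \<open>e n = X (t n) - Y n\<close> and let \<open>A n\<close> be the difference of the explicit parts of one step,
  started from \<open>X (t n)\<close> and from \<open>Y n\<close>. Since \<open>x \<mapsto> - c h / x\<close> is increasing,
  \<open>\<bar>e (n+1)\<bar> \<le> \<bar>A n + R1 (n+1) + R2 (n+1)\<bar>\<close>, and (A4) to (A6) give
  \<open>(A n)\<^sup>2 \<le> (1 + K h) (e n)\<^sup>2\<close>. Squaring and iterating bounds \<open>max (e n)\<^sup>2\<close> by
  \<open>\<Sum> R1\<^sup>2 / h + \<Sum> R2\<^sup>2\<close> and the maximum of \<open>\<Sum> w k A k R2 (k+1)\<close> with bounded weights \<open>w\<close>.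

  The products \<open>A R2\<close> are only \<open>p\<close>-integrable, and for \<open>p = 1\<close> Doob's inequality fails at that
  exponent, so the Burkholder--Davis--Gundy inequality would be needed. Instead, \<open>A k\<close> is divided by
  the running maximum of the weighted \<open>A\<close>, which turns the sum into a martingale \<open>m\<close> with increments
  bounded by \<open>\<bar>R2\<bar>\<close>; Abel summation bounds the original sum by
  \<open>2 max \<bar>e\<bar> max \<bar>m\<bar>\<close> up to constants, and the first factor is absorbed pathwise. For \<open>m\<close> the exponent is
  \<open>2 p \<ge> 2\<close>, where a pathwise Doob inequality and a second order expansion of \<open>\<bar>x\<bar> powr (2 p)\<close> suffice.\<close>

section \<open>Elementary inequalities\<close>

lemma exp_le_quadratic:
  fixes u :: real assumes "\<bar>u\<bar> \<le> 1" shows "exp u \<le> 1 + u + u\<^sup>2"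
proof (cases "0 \<le> u")
  case True then show ?thesis using assms exp_bound[of u] by simp
next
  case False
  define v where "v = - u"
  have v: "0 \<le> v" using False v_def by simp
  \<comment> \<open>For negative \<open>u\<close> the claim says that
    \<open>1 - v + v\<^sup>2\<close> dominates \<open>1 / exp v\<close>; it does so because its
    product with the quadratic Taylor polynomial, a lower bound of \<open>exp v\<close>, is at least
    1.\<close>
  have "1 \<le> (1 - v + v\<^sup>2) * (1 + v + v\<^sup>2 / 2)"
  proof -
    have "(1 - v + v\<^sup>2) * (1 + v + v\<^sup>2 / 2) = 1 + v\<^sup>2/2 + v^3/2 + v^4/2"
      by (simp add: field_simps power2_eq_square power3_eq_cube power4_eq_xxxx)
    then show ?thesis using v by simp
  qed
  also have "\<dots> \<le> (1 - v + v\<^sup>2) * exp v"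
  proof (intro mult_left_mono exp_lower_Taylor_quadratic v)
    have "0 \<le> (v - 1/2)\<^sup>2 + 3/4" by simp
    then show "0 \<le> 1 - v + v\<^sup>2" by (simp add: power2_eq_square field_simps)
  qed
  finally have "exp (- v) \<le> 1 - v + v\<^sup>2" by (simp add: exp_minus field_simps)
  then show ?thesis by (simp add: v_def)
qed

text \<open>There are two regimes. For small \<open>t\<close>, \<open>ln (1 + t) \<le> t\<close> and
  the quadratic bound on \<open>exp\<close> give the expansion with error
  \<open>q\<^sup>2 * t\<^sup>2\<close>. Otherwise \<open>\<bar>t\<bar>\<close> exceeds
  \<open>1 / q\<close>, so constants and linear terms are dominated by multiples of
  \<open>\<bar>t\<bar> powr q\<close>.\<close>

lemma abs_one_plus_powr_le:
  fixes q t :: real assumes q: "2 \<le> q"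
  shows "\<bar>1 + t\<bar> powr q \<le> 1 + q * t + ((q + 1) powr q + q powr q + q\<^sup>2) * (t\<^sup>2 + \<bar>t\<bar> powr q)"
    (is "_ \<le> _ + ?C * _")
proof (cases "\<bar>q * t\<bar> \<le> 1")
  case True
  have "\<bar>t\<bar> \<le> 1/2"
  proof -
    have "2 * \<bar>t\<bar> \<le> q * \<bar>t\<bar>" using q by (intro mult_right_mono) auto
    then show ?thesis using True q by (simp add: abs_mult)
  qed
  then have t: "0 < 1 + t" by linarith
  have "\<bar>1 + t\<bar> powr q = exp (q * ln (1 + t))" using t by (simp add: powr_def)
  also have "\<dots> \<le> exp (q * t)" using t q ln_le_minus_one[of "1+t"] by simp
  also have "\<dots> \<le> 1 + q * t + (q * t)\<^sup>2" by (rule exp_le_quadratic[OF True])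
  also have "(q * t)\<^sup>2 = q\<^sup>2 * t\<^sup>2" by (simp add: power_mult_distrib)
  also have "q\<^sup>2 * t\<^sup>2 \<le> ?C * (t\<^sup>2 + \<bar>t\<bar> powr q)"
    by (intro mult_mono) auto
  finally show ?thesis by simp
next
  case False
  then have f: "1 < q * \<bar>t\<bar>" using q by (simp add: abs_mult)
  have "\<bar>1 + t\<bar> \<le> (q + 1) * \<bar>t\<bar>" using f by (simp add: algebra_simps)
  then have "\<bar>1 + t\<bar> powr q \<le> ((q + 1) * \<bar>t\<bar>) powr q" using q by (intro powr_mono2) auto
  also have "\<dots> = (q + 1) powr q * \<bar>t\<bar> powr q" using q by (simp add: powr_mult)
  finally have 1: "\<bar>1 + t\<bar> powr q \<le> (q + 1) powr q * \<bar>t\<bar> powr q" .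
  \<comment> \<open>In this regime \<open>1 + q * t\<close> can be negative; the summand
    \<open>q powr q\<close> of the constant compensates for that.\<close>
  have "- (1 + q * t) \<le> q * \<bar>t\<bar>" using q abs_ge_minus_self[of "q*t"] by (simp add: abs_mult)
  also have "\<dots> = (q * \<bar>t\<bar>) powr 1" using f by simp
  also have "\<dots> \<le> (q * \<bar>t\<bar>) powr q" using f q by (intro powr_mono) auto
  also have "\<dots> = q powr q * \<bar>t\<bar> powr q" using q by (simp add: powr_mult)
  finally have 2: "0 \<le> 1 + q * t + q powr q * \<bar>t\<bar> powr q" by linarith
  have "((q + 1) powr q + q powr q) * \<bar>t\<bar> powr q \<le> ?C * (t\<^sup>2 + \<bar>t\<bar> powr q)"
    by (intro mult_mono) auto
  then have "(q + 1) powr q * \<bar>t\<bar> powr q + q powr q * \<bar>t\<bar> powr q \<le> ?C * (t\<^sup>2 + \<bar>t\<bar> powr q)"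
    by (simp only: distrib_right)
  then show ?thesis using 1 2 by linarith
qed

text \<open>A Young inequality with free parameter: either
  \<open>y\<^sup>2 \<le> x\<^sup>2 / \<nu>\<close>, or \<open>x\<^sup>2\<close> is below
  \<open>\<nu> * y\<^sup>2\<close> and the power of \<open>x\<close> can be traded for one of
  \<open>y\<close>. A large \<open>\<nu>\<close> makes the coefficient of
  \<open>\<bar>x\<bar> powr q\<close> small.\<close>

lemma powr_diff_mult_square_le:
  fixes x y q \<nu> :: real assumes q: "2 \<le> q" and \<nu>: "0 < \<nu>"
  shows "\<bar>x\<bar> powr (q - 2) * y\<^sup>2 \<le> \<bar>x\<bar> powr q / \<nu> + \<nu> powr (q / 2 - 1) * \<bar>y\<bar> powr q"
proof (cases "x = 0 \<or> y = 0")
  case True then show ?thesis using q \<nu> by auto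
next
  case False
  then have xy: "0 < \<bar>x\<bar>" "0 < \<bar>y\<bar>" by auto
  have ex: "\<bar>z\<bar> powr q = \<bar>z\<bar> powr (q - 2) * z\<^sup>2" if "0 < \<bar>z\<bar>" for z :: real
    using that powr_add[of "\<bar>z\<bar>" "q - 2" 2] by (simp add: powr_numeral)
  show ?thesis
  proof (cases "\<nu> * y\<^sup>2 \<le> x\<^sup>2")
    case True
    then have "\<bar>x\<bar> powr (q - 2) * y\<^sup>2 \<le> \<bar>x\<bar> powr (q - 2) * (x\<^sup>2 / \<nu>)"
      using \<nu> by (intro mult_left_mono) (auto simp: field_simps)
    also have "\<dots> = \<bar>x\<bar> powr q / \<nu>" using ex[OF xy(1)] by simp
    finally show ?thesis using \<nu> by (smt (verit) mult_nonneg_nonneg powr_ge_zero)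
  next
    case False
    have "\<bar>x\<bar> powr (q - 2) = (x\<^sup>2) powr (q / 2 - 1)"
      using xy powr_powr[of "\<bar>x\<bar>" 2 "q/2 - 1"] by (simp add: powr_numeral)
    also have "\<dots> \<le> (\<nu> * y\<^sup>2) powr (q / 2 - 1)" using False q by (intro powr_mono2) auto
    also have "\<dots> = \<nu> powr (q / 2 - 1) * \<bar>y\<bar> powr (q - 2)"
      using xy \<nu> powr_powr[of "\<bar>y\<bar>" 2 "q/2 - 1"] by (simp add: powr_mult powr_numeral)
    finally have "\<bar>x\<bar> powr (q - 2) * y\<^sup>2 \<le> \<nu> powr (q / 2 - 1) * \<bar>y\<bar> powr (q - 2) * y\<^sup>2"
      by (intro mult_right_mono) auto
    also have "\<dots> = \<nu> powr (q / 2 - 1) * \<bar>y\<bar> powr q" using ex[OF xy(2)] by simp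
    finally show ?thesis using \<nu> by (smt (verit) divide_nonneg_nonneg powr_ge_zero)
  qed
qed

text \<open>This is the expansion of \<open>\<bar>1 + t\<bar> powr q\<close> scaled by
  \<open>x\<close>, with \<open>t = y / x\<close>. The term linear in \<open>y\<close> has mean zero
  when \<open>y\<close> is a martingale increment; taking for \<open>\<nu>\<close> the number of
  steps keeps the accumulated factors \<open>1 + C / \<nu>\<close> bounded.\<close>

lemma abs_add_powr_le:
  fixes q :: real assumes q: "2 \<le> q"
  obtains C where "1 \<le> C" "\<And>x y \<nu>. 1 \<le> \<nu> \<Longrightarrow>
    \<bar>x + y\<bar> powr q \<le> (1 + C / \<nu>) * \<bar>x\<bar> powr q + q * sgn x * \<bar>x\<bar> powr (q - 1) * y
       + 2 * C * \<nu> powr (q / 2 - 1) * \<bar>y\<bar> powr q"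
proof
  let ?C = "(q + 1) powr q + q powr q + q\<^sup>2"
  have "1 \<le> q\<^sup>2" using q by (simp add: power2_eq_square) (smt (verit) mult_le_cancel_left1)
  then show C1: "1 \<le> ?C" by (smt (verit) powr_ge_zero)
  fix x y \<nu> :: real assume \<nu>: "1 \<le> \<nu>"
  have n1: "1 \<le> \<nu> powr (q / 2 - 1)" using \<nu> q by (simp add: ge_one_powr_ge_zero)
  show "\<bar>x + y\<bar> powr q \<le> (1 + ?C / \<nu>) * \<bar>x\<bar> powr q + q * sgn x * \<bar>x\<bar> powr (q - 1) * y
       + 2 * ?C * \<nu> powr (q / 2 - 1) * \<bar>y\<bar> powr q"
  proof (cases "x = 0")
    case True
    have "1 * \<bar>y\<bar> powr q \<le> (2 * ?C * \<nu> powr (q / 2 - 1)) * \<bar>y\<bar> powr q"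
    proof (intro mult_right_mono)
      have "1 * 1 \<le> (2 * ?C) * \<nu> powr (q / 2 - 1)" using C1 n1 by (intro mult_mono) auto
      then show "1 \<le> 2 * ?C * \<nu> powr (q / 2 - 1)" by simp
    qed simp
    then show ?thesis using True q by simp
  next
    case False
    define t where "t = y / x"
    have y: "y = x * t" and x: "0 < \<bar>x\<bar>" using False by (auto simp: t_def)
    have "\<bar>x + y\<bar> powr q = \<bar>x\<bar> powr q * \<bar>1 + t\<bar> powr q"
      by (simp add: y powr_mult[symmetric] abs_mult[symmetric] algebra_simps)
    also have "\<dots> \<le> \<bar>x\<bar> powr q * (1 + q * t + ?C * (t\<^sup>2 + \<bar>t\<bar> powr q))"
      by (intro mult_left_mono abs_one_plus_powr_le q) auto
    also have "\<dots> = \<bar>x\<bar> powr q + q * (\<bar>x\<bar> powr q * t) + ?C * (\<bar>x\<bar> powr q * t\<^sup>2 + \<bar>x\<bar> powr q * \<bar>t\<bar> powr q)"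
      by (simp add: algebra_simps)
    also have "\<bar>x\<bar> powr q * t = sgn x * \<bar>x\<bar> powr (q - 1) * y"
      using x powr_add[of "\<bar>x\<bar>" "q - 1" 1] by (simp add: y sgn_if)
    also have "\<bar>x\<bar> powr q * t\<^sup>2 = \<bar>x\<bar> powr (q - 2) * y\<^sup>2"
      using x powr_add[of "\<bar>x\<bar>" "q - 2" 2] by (simp add: y powr_numeral power_mult_distrib)
    also have "\<bar>x\<bar> powr q * \<bar>t\<bar> powr q = \<bar>y\<bar> powr q"
      by (simp add: y powr_mult abs_mult)
    also have "?C * (\<bar>x\<bar> powr (q - 2) * y\<^sup>2 + \<bar>y\<bar> powr q)
      \<le> ?C * (\<bar>x\<bar> powr q / \<nu> + \<nu> powr (q / 2 - 1) * \<bar>y\<bar> powr q + \<nu> powr (q / 2 - 1) * \<bar>y\<bar> powr q)"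
    proof (intro mult_left_mono add_mono powr_diff_mult_square_le q)
      show "\<bar>y\<bar> powr q \<le> \<nu> powr (q / 2 - 1) * \<bar>y\<bar> powr q"
        using mult_right_mono[OF n1, of "\<bar>y\<bar> powr q"] by simp
    qed (use \<nu> C1 in auto)
    finally have "\<bar>x + y\<bar> powr q \<le> \<bar>x\<bar> powr q + q * (sgn x * \<bar>x\<bar> powr (q - 1) * y)
        + ?C * (\<bar>x\<bar> powr q / \<nu> + \<nu> powr (q / 2 - 1) * \<bar>y\<bar> powr q + \<nu> powr (q / 2 - 1) * \<bar>y\<bar> powr q)"
      by simp
    moreover have "A + q * B + K * (A / \<nu> + E + E) = (1 + K / \<nu>) * A + q * B + 2 * K * E" for A B E K :: real
      by (simp add: algebra_simps)
    ultimately show ?thesis by (simp only: mult.assoc)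
  qed
qed

section \<open>Running maxima, the pathwise Doob inequality and Abel summation\<close>

primrec running_max :: "(nat \<Rightarrow> real) \<Rightarrow> nat \<Rightarrow> real" where
  "running_max x 0 = \<bar>x 0\<bar>"
| "running_max x (Suc n) = max (running_max x n) \<bar>x (Suc n)\<bar>"

lemma abs_le_running_max: "k \<le> n \<Longrightarrow> \<bar>x k\<bar> \<le> running_max x n"
  by (induction n) (auto simp: le_Suc_eq le_max_iff_disj)

lemma running_max_nonneg: "0 \<le> running_max x n"
  by (meson abs_ge_zero abs_le_running_max le_refl order_trans)

lemma running_max_attained: "\<exists>k\<le>n. running_max x n = \<bar>x k\<bar>"
  by (induction n) (auto simp: max_def intro: le_SucI)

lemma running_max_mono: "m \<le> n \<Longrightarrow> running_max x m \<le> running_max x n"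
  by (rule lift_Suc_mono_le) auto

lemma borel_measurable_running_max [measurable (raw)]:
  assumes "\<And>k. k \<le> n \<Longrightarrow> (\<lambda>\<omega>. x \<omega> k) \<in> borel_measurable M"
  shows "(\<lambda>\<omega>. running_max (x \<omega>) n) \<in> borel_measurable M"
  using assms by (induction n) auto

text \<open>Young's inequality with exponents \<open>q / (q - 1)\<close> and \<open>q\<close>;
  equivalently, the graph of \<open>t powr q\<close> lies above its tangent at
  \<open>v\<close>.\<close>

lemma Young_powr_minus_one:
  fixes u v q :: real assumes q: "1 < q" and "0 \<le> u" "0 \<le> v"
  shows "v powr (q - 1) * u \<le> u powr q / q + (1 - 1 / q) * v powr q"
proof -
  have "v powr (q - 1) * u \<le> (v powr (q - 1)) powr (q / (q - 1)) / (q / (q - 1)) + u powr q / q"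
    using assms by (intro Youngs_inequality) (auto simp: field_simps)
  also have "(v powr (q - 1)) powr (q / (q - 1)) = v powr q"
    using q by (simp add: powr_powr)
  finally show ?thesis using q by (simp add: field_simps)
qed

text \<open>The pathwise form of Doob's maximal inequality of Acciaio, Beiglboeck, Penkner, Schachermayer
  and Temme: for a martingale the sum on the right has mean zero.\<close>

lemma pathwise_Doob:
  fixes x :: "nat \<Rightarrow> real" and q :: real assumes q: "1 < q"
  shows "(1 - 1 / q) * running_max x n powr q \<le> running_max x n powr (q - 1) * \<bar>x n\<bar>
     - (\<Sum>k<n. running_max x k powr (q - 1) * sgn (x k) * (x (Suc k) - x k))"
proof (induction n)
  case 0
  have "\<bar>x 0\<bar> powr q = \<bar>x 0\<bar> powr (q - 1) * \<bar>x 0\<bar>"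
    using powr_mult_base[of "\<bar>x 0\<bar>" "q - 1"] by (simp add: mult.commute)
  moreover have "(1 - 1 / q) * \<bar>x 0\<bar> powr q \<le> 1 * \<bar>x 0\<bar> powr q"
    using q by (intro mult_right_mono) auto
  ultimately show ?case by simp
next
  case (Suc n)
  let ?u = "running_max x (Suc n)" and ?v = "running_max x n"
  have v: "0 \<le> ?v" by (rule running_max_nonneg)
  \<comment> \<open>\<open>sgn (x n)\<close> is a subgradient of the absolute value at
    \<open>x n\<close>.\<close>
  have "sgn (x n) * (x (Suc n) - x n) \<le> \<bar>x (Suc n)\<bar> - \<bar>x n\<bar>"
    by (auto simp: sgn_if)
  from mult_left_mono[OF this, of "?v powr (q - 1)"]
  have 1: "?v powr (q - 1) * sgn (x n) * (x (Suc n) - x n)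
      \<le> ?v powr (q - 1) * \<bar>x (Suc n)\<bar> - ?v powr (q - 1) * \<bar>x n\<bar>"
    by (simp add: algebra_simps)
  \<comment> \<open>The running maximum changes only when \<open>\<bar>x (Suc n)\<bar>\<close> is a
    new maximum; then the claim is the tangent inequality between the old and the new
    maximum.\<close>
  have 2: "(1 - 1 / q) * ?u powr q - (1 - 1 / q) * ?v powr q
      \<le> ?u powr (q - 1) * \<bar>x (Suc n)\<bar> - ?v powr (q - 1) * \<bar>x (Suc n)\<bar>"
  proof (cases "\<bar>x (Suc n)\<bar> \<le> ?v")
    case True then show ?thesis by (simp add: max_def)
  next
    case False
    then have u: "?u = \<bar>x (Suc n)\<bar>" by simp
    have "?v powr (q - 1) * ?u \<le> ?u powr q / q + (1 - 1 / q) * ?v powr q"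
      using q v by (intro Young_powr_minus_one running_max_nonneg)
    moreover have "?u powr q = ?u powr (q - 1) * ?u"
      using powr_mult_base[of ?u "q - 1"] by (simp add: mult.commute running_max_nonneg del: running_max.simps)
    ultimately show ?thesis unfolding u by (simp add: algebra_simps)
  qed
  show ?case using Suc 1 2 by (simp del: running_max.simps)
qed

text \<open>In the pathwise Doob inequality \<open>1 - 1 / q\<close> is at least
  \<open>1 / 2\<close>, and the product of the maximum with \<open>\<bar>x n\<bar>\<close> costs at
  most a quarter of the maximum's power plus a multiple of \<open>\<bar>x n\<bar> powr q\<close>.
  Absorbing that quarter and multiplying by 4 gives the constants.\<close>

lemma running_max_powr_le:
  fixes x :: "nat \<Rightarrow> real" and q :: real assumes q: "2 \<le> q"
  shows "running_max x n powr q \<le> 4 powr (q + 1) * \<bar>x n\<bar> powr q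
     - 4 * (\<Sum>k<n. running_max x k powr (q - 1) * sgn (x k) * (x (Suc k) - x k))"
proof -
  let ?u = "running_max x n"
  have u: "0 \<le> ?u" by (rule running_max_nonneg)
  have sp: "z powr q = z powr (q - 1) * z" if "0 \<le> z" for z :: real
    using powr_mult_base[of z "q - 1"] that by (simp add: mult.commute)
  have "?u powr (q - 1) * \<bar>x n\<bar> \<le> ?u powr q / 4 + 4 powr q * \<bar>x n\<bar> powr q"
  proof (cases "\<bar>x n\<bar> \<le> ?u / 4")
    case True
    then have "?u powr (q - 1) * \<bar>x n\<bar> \<le> ?u powr (q - 1) * (?u / 4)" by (intro mult_left_mono) auto
    then show ?thesis using sp[OF u] by (smt (verit) mult_nonneg_nonneg powr_ge_zero times_divide_eq_right)
  next
    case False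
    then have "?u powr (q - 1) * \<bar>x n\<bar> \<le> (4 * \<bar>x n\<bar>) powr (q - 1) * (4 * \<bar>x n\<bar>)"
      using q u by (intro mult_mono powr_mono2) auto
    also have "\<dots> = 4 powr q * \<bar>x n\<bar> powr q" by (subst sp[symmetric]) (simp_all add: powr_mult)
    finally show ?thesis by (smt (verit) divide_nonneg_nonneg powr_ge_zero)
  qed
  moreover have "1 / 2 * ?u powr q \<le> (1 - 1 / q) * ?u powr q"
    using q by (intro mult_right_mono) (auto simp: field_simps)
  moreover have "4 powr (q + 1) = 4 * (4 powr q :: real)" by (simp add: powr_add)
  ultimately show ?thesis using pathwise_Doob[of q x n] q by simp
qed

lemma abs_add_powr_le_double:
  fixes x y q :: real assumes "0 \<le> q"
  shows "\<bar>x + y\<bar> powr q \<le> 2 powr q * (\<bar>x\<bar> powr q + \<bar>y\<bar> powr q)"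
proof -
  have "\<bar>x + y\<bar> powr q \<le> (2 * max \<bar>x\<bar> \<bar>y\<bar>) powr q" using assms by (intro powr_mono2) auto
  also have "\<dots> = 2 powr q * max \<bar>x\<bar> \<bar>y\<bar> powr q" by (simp add: powr_mult)
  also have "\<dots> \<le> 2 powr q * (\<bar>x\<bar> powr q + \<bar>y\<bar> powr q)"
    by (intro mult_left_mono) (auto simp: max_def)
  finally show ?thesis .
qed

lemma powr_minus_one_mult_le:
  fixes u v q :: real assumes "1 < q" "0 \<le> u" "0 \<le> v"
  shows "u powr (q - 1) * v \<le> u powr q + v powr q"
proof -
  have "u powr (q - 1) * v \<le> v powr q / q + (1 - 1 / q) * u powr q"
    by (rule Young_powr_minus_one) (use assms in auto)
  also have "\<dots> \<le> v powr q / 1 + 1 * u powr q"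
    using assms by (intro add_mono divide_left_mono mult_right_mono) auto
  finally show ?thesis by simp
qed

text \<open>Abel summation: a sum with weights \<open>b\<close> is controlled by the partial sums with the normalised
  weights \<open>b k / running_max b k\<close>, which lie in \<open>[-1, 1]\<close>; where the running maximum vanishes,
  so does \<open>b\<close>, and the junk value \<open>0 / 0 = 0\<close> is the right one.\<close>

lemma abs_weighted_sum_le:
  fixes b r :: "nat \<Rightarrow> real"
  defines "m \<equiv> \<lambda>n. \<Sum>k<n. b k / running_max b k * r k"
  shows "\<bar>\<Sum>k<n. b k * r k\<bar> \<le> 2 * running_max b (n - 1) * running_max m n"
proof (cases n)
  \<comment> \<open>Both sides vanish here, since \<open>m 0\<close> is an empty sum, so the
    truncated \<open>n - 1\<close> does no harm.\<close>
  case 0 then show ?thesis by (simp add: m_def)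
next
  case (Suc n')
  let ?Z = "running_max b"
  have bZ: "b k = ?Z k * (b k / ?Z k)" for k
  proof (cases "?Z k = 0")
    case True then show ?thesis using abs_le_running_max[of k k b] by simp
  qed simp
  \<comment> \<open>From one \<open>j\<close> to the next the difference inside the absolute value
    changes by \<open>- (?Z (Suc j) - ?Z j) * m (Suc j)\<close>. It starts at 0, and the nonnegative
    increments of \<open>?Z\<close> add up to at most \<open>?Z j\<close>.\<close>
  have "\<bar>(\<Sum>k<Suc j. b k * r k) - ?Z j * m (Suc j)\<bar> \<le> ?Z j * running_max m n" if "Suc j \<le> n" for j
    using that
  proof (induction j)
    case 0
    have "(\<Sum>k<Suc 0. b k * r k) - ?Z 0 * m (Suc 0) = 0"
      using bZ[of 0] by (simp add: m_def)
    then show ?case by (metis abs_zero mult_nonneg_nonneg running_max_nonneg)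
  next
    case (Suc j)
    have b: "b (Suc j) * r (Suc j) = ?Z (Suc j) * (m (Suc (Suc j)) - m (Suc j))"
    proof -
      have "?Z (Suc j) * (m (Suc (Suc j)) - m (Suc j)) = ?Z (Suc j) * (b (Suc j) / ?Z (Suc j)) * r (Suc j)"
        by (simp add: m_def del: running_max.simps)
      then show ?thesis using bZ[of "Suc j"] by (simp del: running_max.simps)
    qed
    have "(\<Sum>k<Suc (Suc j). b k * r k) - ?Z (Suc j) * m (Suc (Suc j))
      = ((\<Sum>k<Suc j. b k * r k) - ?Z j * m (Suc j)) - (?Z (Suc j) - ?Z j) * m (Suc j)"
      using b by (simp add: algebra_simps del: running_max.simps)
    also have "\<bar>\<dots>\<bar> \<le> \<bar>(\<Sum>k<Suc j. b k * r k) - ?Z j * m (Suc j)\<bar> + \<bar>(?Z (Suc j) - ?Z j) * m (Suc j)\<bar>"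
      by (rule abs_triangle_ineq4)
    also have "\<dots> \<le> ?Z j * running_max m n + (?Z (Suc j) - ?Z j) * \<bar>m (Suc j)\<bar>"
    proof (rule add_mono)
      show "\<bar>(\<Sum>k<Suc j. b k * r k) - ?Z j * m (Suc j)\<bar> \<le> ?Z j * running_max m n"
        using Suc by simp
      show "\<bar>(?Z (Suc j) - ?Z j) * m (Suc j)\<bar> \<le> (?Z (Suc j) - ?Z j) * \<bar>m (Suc j)\<bar>"
        using running_max_mono[of j "Suc j" b] by (simp add: abs_mult del: running_max.simps)
    qed
    also have "\<dots> \<le> ?Z j * running_max m n + (?Z (Suc j) - ?Z j) * running_max m n"
      using Suc.prems running_max_mono[of j "Suc j" b]
      by (intro add_left_mono mult_left_mono abs_le_running_max) (auto simp del: running_max.simps)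
    also have "\<dots> = ?Z (Suc j) * running_max m n" by (simp add: algebra_simps del: running_max.simps)
    finally show ?case .
  qed
  from this[of n'] Suc have "\<bar>(\<Sum>k<n. b k * r k) - ?Z n' * m n\<bar> \<le> ?Z n' * running_max m n" by simp
  moreover have "\<bar>?Z n' * m n\<bar> \<le> ?Z n' * running_max m n"
    using abs_le_running_max[of n n m] running_max_nonneg[of b n'] by (simp add: abs_mult mult_left_mono)
  moreover have "2 * ?Z (n - 1) * running_max m n = ?Z n' * running_max m n + ?Z n' * running_max m n"
    using Suc by simp
  ultimately show ?thesis by linarith
qed

text \<open>The power mean inequality: the tangent inequality at the average \<open>a\<close>,
  summed over all terms, gives \<open>N * a powr p\<close> as a lower bound for the sum of powers.
  For \<open>p = 1\<close> the tangent lemma does not apply, but both sides agree.\<close>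

lemma sum_powr_le:
  fixes z :: "nat \<Rightarrow> real" assumes p: "1 \<le> p" and z: "\<And>k. 0 \<le> z k" and N: "1 \<le> N"
  shows "(\<Sum>k<N. z k) powr p \<le> real N powr (p - 1) * (\<Sum>k<N. z k powr p)"
proof (cases "p = 1")
  case True
  then show ?thesis using z N by (simp add: sum_nonneg)
next
  case False
  define a where "a = (\<Sum>k<N. z k) / real N"
  have a: "0 \<le> a" "(\<Sum>k<N. z k) = real N * a" using z N by (auto simp: a_def sum_nonneg)
  have Np: "real N powr p = real N powr (p - 1) * real N" for N
    using powr_mult_base[of "real N" "p - 1"] by (simp add: mult.commute)
  have "(\<Sum>k<N. a powr (p - 1) * z k) \<le> (\<Sum>k<N. z k powr p / p + (1 - 1 / p) * a powr p)"
    using False p a z by (intro sum_mono Young_powr_minus_one) auto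
  also have "\<dots> = (\<Sum>k<N. z k powr p) / p + real N * a powr p - real N * a powr p / p"
    by (simp add: sum.distrib sum_divide_distrib[symmetric]) (simp add: algebra_simps)
  also have "(\<Sum>k<N. a powr (p - 1) * z k) = real N * a powr p"
    using powr_mult_base[OF a(1), of "p - 1"] by (simp add: sum_distrib_left[symmetric] a(2) mult.commute[of "a powr (p - 1)" a])
  finally have "real N * a powr p \<le> (\<Sum>k<N. z k powr p)"
    using p by (simp add: divide_le_cancel)
  from mult_left_mono[OF this, of "real N powr (p - 1)"] show ?thesis
    using a by (simp add: powr_mult Np mult.assoc)
qed

lemma add3_powr_le:
  fixes u v w p :: real assumes "0 \<le> p" "0 \<le> u" "0 \<le> v" "0 \<le> w"
  shows "(u + v + w) powr p \<le> 3 powr p * (u powr p + v powr p + w powr p)"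
proof -
  let ?x = "max u (max v w)"
  have "(u + v + w) powr p \<le> (3 * ?x) powr p" using assms by (intro powr_mono2) auto
  also have "\<dots> = 3 powr p * ?x powr p" using assms by (simp add: powr_mult)
  also have "\<dots> \<le> 3 powr p * (u powr p + v powr p + w powr p)"
    by (intro mult_left_mono) (auto simp: max_def)
  finally show ?thesis .
qed

section \<open>Maximal moments of discrete martingales\<close>

text \<open>Here \<open>d n\<close> is the increment from time \<open>n\<close> to time
  \<open>n + 1\<close>. Integrability is left out of the definition and comes from the moment bounds
  that accompany it.\<close>

definition martingale_differences :: "'a measure \<Rightarrow> (nat \<Rightarrow> 'a measure) \<Rightarrow> nat \<Rightarrow> (nat \<Rightarrow> 'a \<Rightarrow> real) \<Rightarrow> bool" where
  "martingale_differences M F N d \<longleftrightarrow>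
     (\<forall>n\<le>N. subalgebra M (F n)) \<and> (\<forall>m n. m \<le> n \<longrightarrow> n \<le> N \<longrightarrow> subalgebra (F n) (F m)) \<and>
     (\<forall>n<N. d n \<in> borel_measurable (F (Suc n)) \<and> (AE \<omega> in M. real_cond_exp M (F n) (d n) \<omega> = 0))"

context prob_space begin

text \<open>Taking out what is known. Integrability is asked of the product only, so that
  \<open>\<phi>\<close> may be an unbounded power of a running maximum.\<close>

lemma expectation_mult_eq_0:
  assumes F: "subalgebra M F" and "AE \<omega> in M. real_cond_exp M F d \<omega> = 0"
    and "\<phi> \<in> borel_measurable F" "d \<in> borel_measurable M" "integrable M (\<lambda>\<omega>. \<phi> \<omega> * d \<omega>)"
  shows "expectation (\<lambda>\<omega>. \<phi> \<omega> * d \<omega>) = 0"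
proof -
  interpret finite_measure_subalgebra M F by unfold_locales (rule F)
  have "expectation (\<lambda>\<omega>. \<phi> \<omega> * d \<omega>) = expectation (\<lambda>\<omega>. \<phi> \<omega> * real_cond_exp M F d \<omega>)"
    using assms by (intro real_cond_exp_intg(2)[symmetric]) auto
  also have "\<dots> = expectation (\<lambda>\<omega>. 0)" 
  proof (rule integral_cong_AE)
    have [measurable]: "\<phi> \<in> borel_measurable M" using assms(3) by (rule measurable_from_subalg[OF F])
    show "(\<lambda>\<omega>. \<phi> \<omega> * real_cond_exp M F d \<omega>) \<in> borel_measurable M" by measurable
  qed (use assms(2) in auto)
  finally show ?thesis by simp
qed

lemma integrable_powr_sum:
  fixes d :: "nat \<Rightarrow> 'a \<Rightarrow> real" and q :: real
  assumes "0 < q" "\<And>k. k < n \<Longrightarrow> d k \<in> borel_measurable M"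
    "\<And>k. k < n \<Longrightarrow> integrable M (\<lambda>\<omega>. \<bar>d k \<omega>\<bar> powr q)"
  shows "integrable M (\<lambda>\<omega>. \<bar>\<Sum>k<n. d k \<omega>\<bar> powr q)"
  using assms(2,3)
proof (induction n)
  case 0 then show ?case using assms(1) by simp
next
  case (Suc n)
  then have [measurable]: "d k \<in> borel_measurable M" if "k \<le> n" for k using that by auto
  have *: "integrable M (\<lambda>\<omega>. 2 powr q * (\<bar>\<Sum>k<n. d k \<omega>\<bar> powr q + \<bar>d n \<omega>\<bar> powr q))"
    using Suc by auto
  show ?case
    by (rule Bochner_Integration.integrable_bound[OF *])
       (use assms(1) in \<open>auto simp: abs_add_powr_le_double\<close>)
qed

lemma integrable_powr_running_max:
  fixes x :: "nat \<Rightarrow> 'a \<Rightarrow> real" and q :: real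
  assumes "0 < q" "\<And>k. k \<le> n \<Longrightarrow> x k \<in> borel_measurable M"
    "\<And>k. k \<le> n \<Longrightarrow> integrable M (\<lambda>\<omega>. \<bar>x k \<omega>\<bar> powr q)"
  shows "integrable M (\<lambda>\<omega>. running_max (\<lambda>k. x k \<omega>) n powr q)"
proof -
  have *: "integrable M (\<lambda>\<omega>. \<Sum>k\<le>n. \<bar>x k \<omega>\<bar> powr q)" using assms by auto
  show ?thesis
  proof (rule Bochner_Integration.integrable_bound[OF *])
    show "(\<lambda>\<omega>. running_max (\<lambda>k. x k \<omega>) n powr q) \<in> borel_measurable M"
      using assms(2) by measurable
    show "AE \<omega> in M. norm (running_max (\<lambda>k. x k \<omega>) n powr q) \<le> norm (\<Sum>k\<le>n. \<bar>x k \<omega>\<bar> powr q)"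
    proof (rule AE_I2)
      fix \<omega>
      obtain k where k: "k \<le> n" "running_max (\<lambda>k. x k \<omega>) n = \<bar>x k \<omega>\<bar>"
        using running_max_attained by blast
      have "\<bar>x k \<omega>\<bar> powr q \<le> (\<Sum>k\<le>n. \<bar>x k \<omega>\<bar> powr q)"
        using k(1) by (intro member_le_sum) auto
      then show "norm (running_max (\<lambda>k. x k \<omega>) n powr q) \<le> norm (\<Sum>k\<le>n. \<bar>x k \<omega>\<bar> powr q)"
        using k by (simp add: sum_nonneg)
    qed
  qed
qed

text \<open>Young's inequality dominates the product by \<open>\<bar>u \<omega>\<bar> powr q +
  \<bar>v \<omega>\<bar> powr q\<close>. This makes the mean-zero terms of the power expansion and
  of the pathwise Doob inequality integrable.\<close>

lemma integrable_powr_mult: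
  fixes u v w :: "'a \<Rightarrow> real" and q :: real
  assumes "1 < q" and [measurable]: "u \<in> borel_measurable M" "v \<in> borel_measurable M"
    and "integrable M (\<lambda>\<omega>. \<bar>u \<omega>\<bar> powr q)" "integrable M (\<lambda>\<omega>. \<bar>v \<omega>\<bar> powr q)"
    and [measurable]: "w \<in> borel_measurable M" and w: "\<And>\<omega>. \<bar>w \<omega>\<bar> \<le> \<bar>u \<omega>\<bar> powr (q - 1)"
  shows "integrable M (\<lambda>\<omega>. w \<omega> * v \<omega>)"
proof -
  have *: "integrable M (\<lambda>\<omega>. \<bar>u \<omega>\<bar> powr q + \<bar>v \<omega>\<bar> powr q)" using assms by auto
  show ?thesis
  proof (rule Bochner_Integration.integrable_bound[OF *])
    show "AE \<omega> in M. norm (w \<omega> * v \<omega>) \<le> norm (\<bar>u \<omega>\<bar> powr q + \<bar>v \<omega>\<bar> powr q)"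
    proof (rule AE_I2)
      fix \<omega>
      have "\<bar>w \<omega> * v \<omega>\<bar> \<le> \<bar>u \<omega>\<bar> powr (q - 1) * \<bar>v \<omega>\<bar>"
        unfolding abs_mult by (rule mult_right_mono[OF w]) simp
      also have "\<dots> \<le> \<bar>u \<omega>\<bar> powr q + \<bar>v \<omega>\<bar> powr q"
        by (rule powr_minus_one_mult_le) (use assms in auto)
      finally show "norm (w \<omega> * v \<omega>) \<le> norm (\<bar>u \<omega>\<bar> powr q + \<bar>v \<omega>\<bar> powr q)" by simp
    qed
  qed measurable
qed

text \<open>In the expansion of the \<open>q\<close>-th power with \<open>\<nu> = N\<close> the
  linear term has mean zero. Over \<open>N\<close> steps the factors \<open>1 + K / N\<close>
  multiply to at most \<open>exp K\<close>, and \<open>N\<close> errors of order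
  \<open>N powr (q / 2 - 1)\<close> add up to the order \<open>N powr (q / 2)\<close>. The pathwise
  Doob inequality then passes from the last value to the maximum. \<open>C\<close> depends on
  \<open>q\<close> alone.\<close>

lemma martingale_maximal_moment:
  fixes q :: real assumes q: "2 \<le> q"
  shows "\<exists>C>0. \<forall>F N d D. martingale_differences M F N d \<longrightarrow>
     (\<forall>n<N. integrable M (\<lambda>\<omega>. \<bar>d n \<omega>\<bar> powr q)) \<longrightarrow> (\<forall>n<N. expectation (\<lambda>\<omega>. \<bar>d n \<omega>\<bar> powr q) \<le> D) \<longrightarrow>
     1 \<le> N \<longrightarrow>
     integrable M (\<lambda>\<omega>. running_max (\<lambda>n. \<Sum>k<n. d k \<omega>) N powr q) \<and>
     expectation (\<lambda>\<omega>. running_max (\<lambda>n. \<Sum>k<n. d k \<omega>) N powr q) \<le> C * real N powr (q / 2) * D"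
proof -
  obtain K where K: "1 \<le> K" and expand: "\<And>x y \<nu>. 1 \<le> \<nu> \<Longrightarrow>
    \<bar>x + y\<bar> powr q \<le> (1 + K / \<nu>) * \<bar>x\<bar> powr q + q * sgn x * \<bar>x\<bar> powr (q - 1) * y
       + 2 * K * \<nu> powr (q / 2 - 1) * \<bar>y\<bar> powr q"
    using abs_add_powr_le[OF q] by metis
  show ?thesis
  proof (intro exI[of _ "4 powr (q + 1) * (exp K * (2 * K))"] conjI allI impI)
    show "0 < 4 powr (q + 1) * (exp K * (2 * K))" using K by simp
    fix F N d D
    assume md: "martingale_differences M F N d"
      and int: "\<forall>n<N. integrable M (\<lambda>\<omega>. \<bar>d n \<omega>\<bar> powr q)"
      and D: "\<forall>n<N. expectation (\<lambda>\<omega>. \<bar>d n \<omega>\<bar> powr q) \<le> D" and N: "1 \<le> N"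
    have sub: "subalgebra M (F n)" if "n \<le> N" for n
      using md that by (auto simp: martingale_differences_def)
    have subm: "subalgebra (F n) (F m)" if "m \<le> n" "n \<le> N" for m n
      using md that by (auto simp: martingale_differences_def)
    have dF: "d k \<in> borel_measurable (F n)" if "k < n" "n \<le> N" for k n
      using md that subm[of "Suc k" n] measurable_from_subalg[of "F n" "F (Suc k)" "d k" borel]
      by (simp add: martingale_differences_def)
    have dM: "d k \<in> borel_measurable M" if "k < N" for k
      using dF[of k N] that sub[of N] by (auto intro: measurable_from_subalg)
    have ce: "AE \<omega> in M. real_cond_exp M (F n) (d n) \<omega> = 0" if "n < N" for n
      using md that by (auto simp: martingale_differences_def)
    define x where "x = (\<lambda>\<omega> n. \<Sum>k<n. d k \<omega>)"
    have xF: "(\<lambda>\<omega>. x \<omega> k) \<in> borel_measurable (F n)" if "k \<le> n" "n \<le> N" for k n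
      unfolding x_def using that by (intro borel_measurable_sum dF) auto
    have xM: "(\<lambda>\<omega>. x \<omega> k) \<in> borel_measurable M" if "k \<le> N" for k
      using xF[of k N] that sub[of N] by (auto intro: measurable_from_subalg)
    have xint: "integrable M (\<lambda>\<omega>. \<bar>x \<omega> n\<bar> powr q)" if "n \<le> N" for n
      unfolding x_def using that int q by (intro integrable_powr_sum dM) auto
    have step: "x \<omega> (Suc n) = x \<omega> n + d n \<omega>" for \<omega> n by (simp add: x_def)
    have rint: "integrable M (\<lambda>\<omega>. running_max (x \<omega>) n powr q)" if "n \<le> N" for n
      using that q by (intro integrable_powr_running_max[where x="\<lambda>k \<omega>. x \<omega> k"] xM xint) auto
    have rM: "(\<lambda>\<omega>. running_max (x \<omega>) n) \<in> borel_measurable M" if "n \<le> N" for n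
      using that by (intro borel_measurable_running_max xM) auto

    \<comment> \<open>\<open>?\<phi> n\<close> and \<open>?\<psi> n\<close> multiply the increment
      \<open>d n\<close> in the power expansion and in the pathwise Doob inequality; both are known
      at time \<open>n\<close> and grow with exponent \<open>q - 1\<close>.\<close>
    let ?\<phi> = "\<lambda>n \<omega>. q * sgn (x \<omega> n) * \<bar>x \<omega> n\<bar> powr (q - 1)"
    let ?\<psi> = "\<lambda>n \<omega>. running_max (x \<omega>) n powr (q - 1) * sgn (x \<omega> n)"
    have i1: "integrable M (\<lambda>\<omega>. ?\<phi> n \<omega> * d n \<omega>)" if "n < N" for n
    proof -
      have "integrable M (\<lambda>\<omega>. (sgn (x \<omega> n) * \<bar>x \<omega> n\<bar> powr (q - 1)) * d n \<omega>)"
        using that xM[of n] dM[of n] q int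
        by (intro integrable_powr_mult[where q=q and u="\<lambda>\<omega>. x \<omega> n"] xint) (auto simp: abs_mult sgn_if)
      from integrable_mult_right[OF this, of q] show ?thesis by (simp add: mult.assoc)
    qed
    have i2: "integrable M (\<lambda>\<omega>. ?\<psi> n \<omega> * d n \<omega>)" if "n < N" for n
      using that xM[of n] dM[of n] q int rM[of n] rint[of n]
      by (intro integrable_powr_mult[where q=q and u="\<lambda>\<omega>. running_max (x \<omega>) n"])
         (auto simp: abs_mult sgn_if running_max_nonneg)
    have z1: "expectation (\<lambda>\<omega>. ?\<phi> n \<omega> * d n \<omega>) = 0" if "n < N" for n
      using that xF[of n n] by (intro expectation_mult_eq_0[OF sub ce] i1 dM) auto
    have z2: "expectation (\<lambda>\<omega>. ?\<psi> n \<omega> * d n \<omega>) = 0" if "n < N" for n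
    proof (intro expectation_mult_eq_0[OF sub ce] i2 dM that)
      have [measurable]: "(\<lambda>\<omega>. running_max (x \<omega>) n) \<in> borel_measurable (F n)"
        using that by (intro borel_measurable_running_max xF) auto
      have [measurable]: "(\<lambda>\<omega>. x \<omega> n) \<in> borel_measurable (F n)" using that by (intro xF) auto
      show "?\<psi> n \<in> borel_measurable (F n)" by measurable
    qed (use that in auto)

    let ?E = "\<lambda>n. expectation (\<lambda>\<omega>. \<bar>x \<omega> n\<bar> powr q)" and ?a = "1 + K / real N"
    let ?b = "2 * K * real N powr (q / 2 - 1) * D"
    have "0 \<le> expectation (\<lambda>\<omega>. \<bar>d 0 \<omega>\<bar> powr q)" by simp
    also have "\<dots> \<le> D" using D N by simp
    finally have D0: "0 \<le> D" .
    have rec: "?E (Suc n) \<le> ?a * ?E n + ?b" if n: "n < N" for n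
    proof -
      have "?E (Suc n) \<le> expectation (\<lambda>\<omega>. ?a * \<bar>x \<omega> n\<bar> powr q + ?\<phi> n \<omega> * d n \<omega>
          + 2 * K * real N powr (q / 2 - 1) * \<bar>d n \<omega>\<bar> powr q)"
      proof (intro integral_mono)
        show "\<bar>x \<omega> (Suc n)\<bar> powr q \<le> ?a * \<bar>x \<omega> n\<bar> powr q + ?\<phi> n \<omega> * d n \<omega>
          + 2 * K * real N powr (q / 2 - 1) * \<bar>d n \<omega>\<bar> powr q" for \<omega>
          unfolding step using N by (intro expand) simp
      qed (use n int xint i1 in auto)
      also have "\<dots> = ?a * ?E n + 0 + 2 * K * real N powr (q / 2 - 1) * expectation (\<lambda>\<omega>. \<bar>d n \<omega>\<bar> powr q)"
        using n int xint i1 z1[OF n] by simp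
      also have "\<dots> \<le> ?a * ?E n + 0 + ?b" using D n K by (intro add_left_mono mult_left_mono) auto
      finally show ?thesis by simp
    qed
    have a1: "1 \<le> ?a" using K by simp
    have b0: "0 \<le> ?b" using K D0 by simp
    \<comment> \<open>A discrete Gronwall argument from \<open>?E 0 = 0\<close>: each of the
      \<open>n\<close> additive errors is amplified by at most \<open>?a ^ n\<close>.\<close>
    have bound: "?E n \<le> ?a ^ n * (real n * ?b)" if "n \<le> N" for n
      using that
    proof (induction n)
      case 0 then show ?case using q by (simp add: x_def)
    next
      case (Suc n)
      have "?E (Suc n) \<le> ?a * ?E n + ?b" using rec Suc by simp
      also have "\<dots> \<le> ?a * (?a ^ n * (real n * ?b)) + ?a ^ Suc n * ?b"
        using Suc a1 b0 mult_right_mono[OF one_le_power[OF a1, of "Suc n"] b0]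
        by (intro add_mono mult_left_mono) auto
      also have "\<dots> = ?a ^ Suc n * (real (Suc n) * ?b)" by (simp add: algebra_simps)
      finally show ?case .
    qed
    have "?a ^ N \<le> exp (K / real N) ^ N"
      using a1 by (intro power_mono exp_ge_add_one_self) auto
    also have "\<dots> = exp K" using N by (simp add: exp_of_nat_mult[symmetric])
    finally have aN: "?a ^ N \<le> exp K" .
    have "?E N \<le> ?a ^ N * (real N * ?b)" by (rule bound) simp
    also have "\<dots> \<le> exp K * (real N * ?b)"
      by (intro mult_right_mono aN mult_nonneg_nonneg[OF of_nat_0_le_iff b0])
    also have "real N * ?b = 2 * K * (real N * real N powr (q / 2 - 1)) * D" by simp
    also have "real N * real N powr (q / 2 - 1) = real N powr (q / 2)"
      using N by (simp add: powr_mult_base)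
    finally have EN: "?E N \<le> exp K * (2 * K) * real N powr (q / 2) * D" by simp

    show "integrable M (\<lambda>\<omega>. running_max (\<lambda>n. \<Sum>k<n. d k \<omega>) N powr q)"
      using rint[of N] by (simp add: x_def)
    have "expectation (\<lambda>\<omega>. running_max (x \<omega>) N powr q) \<le>
      expectation (\<lambda>\<omega>. 4 powr (q + 1) * \<bar>x \<omega> N\<bar> powr q - 4 * (\<Sum>k<N. ?\<psi> k \<omega> * d k \<omega>))"
    proof (intro integral_mono)
      show "integrable M (\<lambda>\<omega>. 4 powr (q + 1) * \<bar>x \<omega> N\<bar> powr q - 4 * (\<Sum>k<N. ?\<psi> k \<omega> * d k \<omega>))"
        using xint[of N] i2
        by (intro Bochner_Integration.integrable_diff integrable_mult_right Bochner_Integration.integrable_sum) auto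
      show "running_max (x \<omega>) N powr q \<le> 4 powr (q + 1) * \<bar>x \<omega> N\<bar> powr q - 4 * (\<Sum>k<N. ?\<psi> k \<omega> * d k \<omega>)" for \<omega>
        using running_max_powr_le[OF q, of "x \<omega>" N] by (simp add: step)
    qed (rule rint, simp)
    also have "\<dots> = 4 powr (q + 1) * ?E N - 4 * (\<Sum>k<N. expectation (\<lambda>\<omega>. ?\<psi> k \<omega> * d k \<omega>))"
      using xint[of N] i2 by (subst Bochner_Integration.integral_diff) auto
    also have "\<dots> = 4 powr (q + 1) * ?E N" using z2 by simp
    also have "\<dots> \<le> 4 powr (q + 1) * (exp K * (2 * K) * real N powr (q / 2) * D)"
      using EN by (intro mult_left_mono) auto
    finally show "expectation (\<lambda>\<omega>. running_max (\<lambda>n. \<Sum>k<n. d k \<omega>) N powr q)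
        \<le> 4 powr (q + 1) * (exp K * (2 * K)) * real N powr (q / 2) * D"
      by (simp add: x_def mult.assoc)
  qed
qed

end

section \<open>Stability of perturbed recursions\<close>

text \<open>Discounting the squared errors by powers of the growth factor
  \<open>1 + (1 + 2 * K) * h\<close> makes their recursion telescope. The discount stays inside the
  weights \<open>b\<close> of the signed sum. Abel summation bounds that sum by a product containing
  the maximal error, which is absorbed on the left. As this happens path by path, no moment of
  \<open>e\<close> has to be finite beforehand.\<close>

lemma pathwise_stability:
  fixes e A r1 r2 :: "nat \<Rightarrow> real" and h K T :: real and N :: nat
  assumes h: "0 < h" "h \<le> 1" "h * real N = T" and K: "0 \<le> K" and e0: "e 0 = 0"
    and step: "\<And>n. n < N \<Longrightarrow> \<bar>e (Suc n)\<bar> \<le> \<bar>A n + r1 n + r2 n\<bar>"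
    and A: "\<And>n. n < N \<Longrightarrow> (A n)\<^sup>2 \<le> (1 + K * h) * (e n)\<^sup>2"
  defines "b \<equiv> \<lambda>k. A k / (1 + (1 + 2 * K) * h) ^ Suc k"
  defines "m \<equiv> \<lambda>n. \<Sum>k<n. b k / running_max b k * r2 k"
  shows "(running_max e N)\<^sup>2 \<le> 16 * (exp ((1 + 2 * K) * T))\<^sup>2 * (2 + 2 * K) * (running_max m N)\<^sup>2
     + 6 * exp ((1 + 2 * K) * T) * ((\<Sum>k<N. (r1 k)\<^sup>2) / h + (\<Sum>k<N. (r2 k)\<^sup>2))"
proof -
  \<comment> \<open>\<open>?Q\<close> dominates \<open>(1 + h) * (1 + K * h)\<close> for
    \<open>h \<le> 1\<close>; the first factor comes from Young's inequality for
    \<open>A n * r1 n\<close>, the second from the hypothesis on \<open>A\<close>. \<open>?E\<close>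
    bounds all powers of \<open>?Q\<close> up to \<open>N\<close>.\<close>
  let ?Q = "1 + (1 + 2 * K) * h" and ?E = "exp ((1 + 2 * K) * T)" and ?\<kappa> = "2 + 2 * K"
  let ?m = "running_max m N" and ?\<rho> = "\<lambda>k. 3 / h * (r1 k)\<^sup>2 + 3 * (r2 k)\<^sup>2"
  have Q1: "1 \<le> ?Q" and Q0: "0 < ?Q" using h K by (auto intro: add_pos_nonneg)
  have "(1 + 2 * K) * h \<le> (1 + 2 * K) * 1" using h K by (intro mult_left_mono) auto
  then have Q2: "?Q \<le> ?\<kappa>" by simp
  have QN: "?Q ^ n \<le> ?E" if "n \<le> N" for n
  proof -
    have "?Q ^ n \<le> ?Q ^ N" using that Q1 by (intro power_increasing) auto
    also have "\<dots> \<le> exp ((1 + 2 * K) * h) ^ N" using Q0 by (intro power_mono exp_ge_add_one_self) auto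
    also have "\<dots> = ?E" using h(3) by (simp add: exp_of_nat_mult[symmetric] mult_ac)
    finally show ?thesis .
  qed
  have onestep: "(e (Suc n))\<^sup>2 \<le> ?Q * (e n)\<^sup>2 + 2 * A n * r2 n + ?\<rho> n" if n: "n < N" for n
  proof -
    have "(e (Suc n))\<^sup>2 \<le> (A n + r1 n + r2 n)\<^sup>2" using step[OF n] by (simp add: abs_le_square_iff)
    also have "\<dots> = (A n)\<^sup>2 + 2 * A n * r2 n + 2 * A n * r1 n + (r1 n + r2 n)\<^sup>2"
      by (simp add: power2_eq_square algebra_simps)
    \<comment> \<open>The product with \<open>r1\<close> has no cancellation in mean, so it is split
      with weight \<open>h\<close>, at the price of \<open>1 / h\<close>; the product with
      \<open>r2\<close> is kept for the martingale argument.\<close>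
    also have "2 * A n * r1 n \<le> h * (A n)\<^sup>2 + (r1 n)\<^sup>2 / h"
    proof -
      have "0 \<le> (h * A n - r1 n)\<^sup>2 / h" using h by simp
      also have "\<dots> = h * (A n)\<^sup>2 + (r1 n)\<^sup>2 / h - 2 * A n * r1 n"
        using h by (simp add: power2_eq_square field_simps)
      finally show ?thesis by simp
    qed
    also have "(r1 n + r2 n)\<^sup>2 \<le> 2 * (r1 n)\<^sup>2 + 2 * (r2 n)\<^sup>2"
      using zero_le_power2[of "r1 n - r2 n"] by (simp add: power2_eq_square algebra_simps)
    finally have "(e (Suc n))\<^sup>2 \<le> (1 + h) * (A n)\<^sup>2 + 2 * A n * r2 n + ((r1 n)\<^sup>2 / h + 2 * (r1 n)\<^sup>2 + 2 * (r2 n)\<^sup>2)"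
      by (simp add: algebra_simps)
    also have "(1 + h) * (A n)\<^sup>2 \<le> (1 + h) * ((1 + K * h) * (e n)\<^sup>2)"
      using A[OF n] h by (intro mult_left_mono) auto
    also have "\<dots> \<le> ?Q * (e n)\<^sup>2"
    proof -
      have "K * (h * h) \<le> K * h" using h K by (intro mult_left_mono) (auto simp: mult_le_cancel_left2)
      then have "(1 + h) * (1 + K * h) \<le> ?Q" by (simp add: algebra_simps)
      then show ?thesis by (simp only: mult.assoc[symmetric] mult_right_mono zero_le_power2)
    qed
    also have "(r1 n)\<^sup>2 / h + 2 * (r1 n)\<^sup>2 + 2 * (r2 n)\<^sup>2 \<le> ?\<rho> n"
    proof -
      have "(r1 n)\<^sup>2 \<le> (r1 n)\<^sup>2 / h" using h by (simp add: pos_le_divide_eq mult_left_le)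
      moreover have "3 / h * (r1 n)\<^sup>2 = 3 * ((r1 n)\<^sup>2 / h)" by simp
      ultimately show ?thesis using zero_le_power2[of "r2 n"] by linarith
    qed
    finally show ?thesis by simp
  qed
  have acc: "(e n)\<^sup>2 / ?Q ^ n \<le> 2 * (\<Sum>k<n. b k * r2 k) + (\<Sum>k<n. ?\<rho> k)" if "n \<le> N" for n
    using that
  proof (induction n)
    case 0 then show ?case by (simp add: e0)
  next
    case (Suc n)
    have "(e (Suc n))\<^sup>2 / ?Q ^ Suc n \<le> (?Q * (e n)\<^sup>2 + 2 * A n * r2 n + ?\<rho> n) / ?Q ^ Suc n"
      using onestep[of n] Suc Q0 by (intro divide_right_mono) auto
    also have "\<dots> = (e n)\<^sup>2 / ?Q ^ n + 2 * (b n * r2 n) + ?\<rho> n / ?Q ^ Suc n"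
      using Q0 by (simp add: b_def add_divide_distrib)
    \<comment> \<open>The discount may be dropped from the nonnegative terms, but not from the
      signed products.\<close>
    also have "?\<rho> n / ?Q ^ Suc n \<le> ?\<rho> n / 1"
      using one_le_power[OF Q1, of "Suc n"] h by (intro divide_left_mono) (auto intro!: add_nonneg_nonneg)
    finally show ?case using Suc by simp
  qed
  obtain n where n: "n \<le> N" "running_max e N = \<bar>e n\<bar>" using running_max_attained by blast
  then have V: "(running_max e N)\<^sup>2 = (e n)\<^sup>2" by simp
  have m0: "0 \<le> ?m" by (rule running_max_nonneg)
  have sums: "0 \<le> (\<Sum>k<n. ?\<rho> k)" "(\<Sum>k<n. ?\<rho> k) \<le> (\<Sum>k<N. ?\<rho> k)"
    using n h by (auto intro!: sum_nonneg sum_mono2 add_nonneg_nonneg)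
  have \<rho>: "(\<Sum>k<N. ?\<rho> k) = 3 * ((\<Sum>k<N. (r1 k)\<^sup>2) / h + (\<Sum>k<N. (r2 k)\<^sup>2))"
    by (simp add: sum.distrib sum_distrib_left sum_divide_distrib distrib_left)
  show ?thesis
  \<comment> \<open>A maximum attained at time 0 is 0. Otherwise the index
    \<open>k \<le> n - 1\<close> chosen below is smaller than \<open>N\<close>, so the hypothesis on
    \<open>A\<close> applies at \<open>k\<close>.\<close>
  proof (cases "n = 0")
    case True
    then have "(running_max e N)\<^sup>2 = 0" using V e0 by simp
    moreover have "0 \<le> 16 * ?E\<^sup>2 * ?\<kappa> * ?m\<^sup>2" "0 \<le> (\<Sum>k<N. (r1 k)\<^sup>2) / h + (\<Sum>k<N. (r2 k)\<^sup>2)"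
      using K h by (auto intro!: add_nonneg_nonneg sum_nonneg divide_nonneg_nonneg)
    ultimately show ?thesis by simp
  next
    case False
    obtain k where k: "k \<le> n - 1" "running_max b (n - 1) = \<bar>b k\<bar>" using running_max_attained by blast
    let ?z = "running_max b (n - 1)"
    have z0: "0 \<le> ?z" by (rule running_max_nonneg)
    have kN: "k < N" using k n False by simp
    \<comment> \<open>The normalising maximum is itself controlled by the maximal error, which makes
      the absorption possible.\<close>
    have "?z\<^sup>2 = (b k)\<^sup>2" using k by simp
    also have "\<dots> \<le> (A k)\<^sup>2"
    proof -
      have "\<bar>A k\<bar> \<le> ?Q ^ Suc k * \<bar>A k\<bar>" using one_le_power[OF Q1, of "Suc k"]
        by (simp only: mult_le_cancel_right1) simp
      then have "\<bar>b k\<bar> \<le> \<bar>A k\<bar>" using Q0 by (simp add: b_def abs_divide pos_divide_le_eq mult.commute)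
      then show ?thesis by (simp add: abs_le_square_iff)
    qed
    also have "\<dots> \<le> (1 + K * h) * (e k)\<^sup>2" by (rule A[OF kN])
    also have "\<dots> \<le> ?\<kappa> * (running_max e N)\<^sup>2"
    proof (intro mult_mono)
      have "K * h \<le> K * 1" using h K by (intro mult_left_mono) auto
      then show "1 + K * h \<le> ?\<kappa>" using K by simp
      show "(e k)\<^sup>2 \<le> (running_max e N)\<^sup>2"
        using abs_le_running_max[of k N e] kN by (simp add: abs_le_square_iff[symmetric] running_max_nonneg)
    qed (use K in auto)
    finally have z: "?z\<^sup>2 \<le> ?\<kappa> * (running_max e N)\<^sup>2" .
    have mn: "running_max m n \<le> ?m" using n by (intro running_max_mono)
    have "(e n)\<^sup>2 = ?Q ^ n * ((e n)\<^sup>2 / ?Q ^ n)" using Q0 by simp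
    also have "\<dots> \<le> ?E * ((e n)\<^sup>2 / ?Q ^ n)" using QN[OF n(1)] Q0 by (intro mult_right_mono) auto
    also have "\<dots> \<le> ?E * (2 * (2 * ?z * ?m) + (\<Sum>k<N. ?\<rho> k))"
    proof (intro mult_left_mono)
      have "(\<Sum>k<n. b k * r2 k) \<le> 2 * ?z * running_max m n"
        using abs_weighted_sum_le[of b r2 n] unfolding m_def by linarith
      also have "\<dots> \<le> 2 * ?z * ?m" using mn z0 by (intro mult_left_mono) auto
      finally show "(e n)\<^sup>2 / ?Q ^ n \<le> 2 * (2 * ?z * ?m) + (\<Sum>k<N. ?\<rho> k)"
        using acc[OF n(1)] sums by linarith
    qed simp
    also have "\<dots> = 4 * ?E * ?z * ?m + 3 * ?E * ((\<Sum>k<N. (r1 k)\<^sup>2) / h + (\<Sum>k<N. (r2 k)\<^sup>2))"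
      unfolding \<rho> by (simp add: algebra_simps)
    \<comment> \<open>Completing the square with this weight leaves exactly half of the squared
      maximal error on the right. Moving it to the left doubles the other coefficients, hence 16 and
      6 in the statement.\<close>
    also have "4 * ?E * ?z * ?m \<le> ?z\<^sup>2 / (2 * ?\<kappa>) + 8 * ?E\<^sup>2 * ?\<kappa> * ?m\<^sup>2"
    proof -
      have "0 \<le> (?z - 4 * ?E * ?\<kappa> * ?m)\<^sup>2 / (2 * ?\<kappa>)" using K by simp
      also have "\<dots> = ?z\<^sup>2 / (2 * ?\<kappa>) + 8 * ?E\<^sup>2 * ?\<kappa> * ?m\<^sup>2 - 4 * ?E * ?z * ?m"
      proof -
        have gen: "(z - 4 * E * k * m)\<^sup>2 / (2 * k) = z\<^sup>2 / (2 * k) + 8 * E\<^sup>2 * k * m\<^sup>2 - 4 * E * z * m"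
          if "0 < k" for z E k m :: real
          using that by (simp add: power2_eq_square field_simps)
        show ?thesis by (rule gen) (use K in simp)
      qed
      finally show ?thesis by simp
    qed
    also have "?z\<^sup>2 / (2 * ?\<kappa>) \<le> (running_max e N)\<^sup>2 / 2"
    proof -
      have "?z\<^sup>2 / (2 * ?\<kappa>) \<le> ?\<kappa> * (running_max e N)\<^sup>2 / (2 * ?\<kappa>)"
        using z K by (intro divide_right_mono) auto
      moreover have "k * V / (2 * k) = V / 2" if "0 < k" for k V :: real using that by simp
      from this[of ?\<kappa> "(running_max e N)\<^sup>2"] have "?\<kappa> * (running_max e N)\<^sup>2 / (2 * ?\<kappa>) = (running_max e N)\<^sup>2 / 2"
        using K by linarith
      ultimately show ?thesis by linarith
    qed
    finally show ?thesis unfolding V by linarith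
  qed
qed

section \<open>From the pathwise bound to moments\<close>

context prob_space begin

lemma real_cond_exp_mult_eq_0:
  assumes F: "subalgebra M F" and d: "AE \<omega> in M. real_cond_exp M F d \<omega> = 0"
    and "\<phi> \<in> borel_measurable F" "d \<in> borel_measurable M" "integrable M (\<lambda>\<omega>. \<phi> \<omega> * d \<omega>)"
  shows "AE \<omega> in M. real_cond_exp M F (\<lambda>\<omega>. \<phi> \<omega> * d \<omega>) \<omega> = 0"
proof -
  interpret finite_measure_subalgebra M F by unfold_locales (rule F)
  show ?thesis using real_cond_exp_mult[of \<phi> d] d assms(3-5) by auto
qed

text \<open>The pathwise bound is raised to the power \<open>p\<close> and integrated. The
  normalised weights are predictable and bounded by 1, so the maximal inequality applies at exponent
  \<open>2 * p\<close> with the moments of \<open>R2\<close>. Extended nonnegative integrals admit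
  infinite moments on the right and an error \<open>e\<close> without a measurability
  assumption.\<close>

lemma stability_moment:
  fixes p K T :: real assumes p: "1 \<le> p" and K: "0 \<le> K" and T: "0 < T"
  shows "\<exists>C>0. \<forall>F N h e A R1 R2.
    0 < h \<longrightarrow> h \<le> 1 \<longrightarrow> 1 \<le> N \<longrightarrow> h * real N = T \<longrightarrow> martingale_differences M F N R2 \<longrightarrow>
    (\<forall>n<N. A n \<in> borel_measurable (F n)) \<longrightarrow> (\<forall>n<N. R1 n \<in> borel_measurable M) \<longrightarrow>
    (AE \<omega> in M. e 0 \<omega> = 0 \<and> (\<forall>n<N. \<bar>e (Suc n) \<omega>\<bar> \<le> \<bar>A n \<omega> + R1 n \<omega> + R2 n \<omega>\<bar> \<and>
        (A n \<omega>)\<^sup>2 \<le> (1 + K * h) * (e n \<omega>)\<^sup>2)) \<longrightarrow>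
    (\<integral>\<^sup>+\<omega>. ennreal (running_max (\<lambda>n. e n \<omega>) N powr (2 * p)) \<partial>M) \<le> ennreal C *
       (ennreal (1 / h powr (2 * p)) * (SUP n\<in>{..<N}. \<integral>\<^sup>+\<omega>. ennreal (\<bar>R1 n \<omega>\<bar> powr (2 * p)) \<partial>M)
        + ennreal (1 / h powr p) * (SUP n\<in>{..<N}. \<integral>\<^sup>+\<omega>. ennreal (\<bar>R2 n \<omega>\<bar> powr (2 * p)) \<partial>M))"
proof -
  have "2 \<le> 2 * p" using p by simp
  from martingale_maximal_moment[OF this] obtain C0 where C0: "0 < C0" and
    mmm: "\<And>F N d D. martingale_differences M F N d \<Longrightarrow>
     (\<forall>n<N. integrable M (\<lambda>\<omega>. \<bar>d n \<omega>\<bar> powr (2 * p))) \<Longrightarrow> (\<forall>n<N. expectation (\<lambda>\<omega>. \<bar>d n \<omega>\<bar> powr (2 * p)) \<le> D) \<Longrightarrow>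
     1 \<le> N \<Longrightarrow>
     integrable M (\<lambda>\<omega>. running_max (\<lambda>n. \<Sum>k<n. d k \<omega>) N powr (2 * p)) \<and>
     expectation (\<lambda>\<omega>. running_max (\<lambda>n. \<Sum>k<n. d k \<omega>) N powr (2 * p)) \<le> C0 * real N powr p * D"
    by auto
  define E where "E = exp ((1 + 2 * K) * T)"
  define c1 where "c1 = 16 * E\<^sup>2 * (2 + 2 * K)"
  define c2 where "c2 = 6 * E"
  have c: "0 < c1" "0 < c2" using K by (auto simp: c1_def c2_def E_def)
  \<comment> \<open>\<open>\<alpha>\<close> collects the constants of the martingale part,
    \<open>\<beta>\<close> those of the two sums of squares.\<close>
  define \<alpha> where "\<alpha> = 3 powr p * c1 powr p * C0 * T powr p"
  define \<beta> where "\<beta> = 3 powr p * c2 powr p * T powr p"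
  have \<alpha>\<beta>: "0 \<le> \<alpha>" "0 \<le> \<beta>" using C0 by (auto simp: \<alpha>_def \<beta>_def)
  define C where "C = \<alpha> + \<beta>"
  have C: "0 < C" using C0 c T by (auto simp: C_def \<alpha>_def \<beta>_def intro!: mult_pos_pos add_pos_pos)
  show ?thesis
  proof (intro exI[of _ C] conjI C allI impI)
    fix F N h and e A R1 R2 :: "nat \<Rightarrow> 'a \<Rightarrow> real"
    assume h: "0 < h" "h \<le> 1" and N: "1 \<le> N" and hN: "h * real N = T"
      and md: "martingale_differences M F N R2"
      and A: "\<forall>n<N. A n \<in> borel_measurable (F n)" and R1: "\<forall>n<N. R1 n \<in> borel_measurable M"
      and path: "AE \<omega> in M. e 0 \<omega> = 0 \<and> (\<forall>n<N. \<bar>e (Suc n) \<omega>\<bar> \<le> \<bar>A n \<omega> + R1 n \<omega> + R2 n \<omega>\<bar> \<and>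
        (A n \<omega>)\<^sup>2 \<le> (1 + K * h) * (e n \<omega>)\<^sup>2)"
    let ?S1 = "SUP n\<in>{..<N}. \<integral>\<^sup>+\<omega>. ennreal (\<bar>R1 n \<omega>\<bar> powr (2 * p)) \<partial>M"
    let ?S2 = "SUP n\<in>{..<N}. \<integral>\<^sup>+\<omega>. ennreal (\<bar>R2 n \<omega>\<bar> powr (2 * p)) \<partial>M"
    let ?L = "\<integral>\<^sup>+\<omega>. ennreal (running_max (\<lambda>n. e n \<omega>) N powr (2 * p)) \<partial>M"
    have sub: "subalgebra M (F n)" if "n \<le> N" for n
      using md that by (auto simp: martingale_differences_def)
    have subm: "subalgebra (F n) (F m)" if "m \<le> n" "n \<le> N" for m n
      using md that by (auto simp: martingale_differences_def)
    have R2F: "R2 k \<in> borel_measurable (F (Suc k))" if "k < N" for k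
      using md that by (simp add: martingale_differences_def)
    have R2M[measurable]: "R2 k \<in> borel_measurable M" if "k < N" for k
      using R2F[OF that] that sub[of "Suc k"] by (auto intro: measurable_from_subalg)
    have ce: "AE \<omega> in M. real_cond_exp M (F n) (R2 n) \<omega> = 0" if "n < N" for n
      using md that by (auto simp: martingale_differences_def)
    have R1M[measurable]: "R1 k \<in> borel_measurable M" if "k < N" for k using R1 that by simp
    show "?L \<le> ennreal C * (ennreal (1 / h powr (2 * p)) * ?S1 + ennreal (1 / h powr p) * ?S2)"
    \<comment> \<open>If \<open>?S2\<close> is infinite, so is the right side. Otherwise every
      \<open>R2 n\<close> has a finite moment of order \<open>2 * p\<close>; \<open>?S1\<close> may
      be infinite throughout.\<close>
    proof (cases "?S2 = \<infinity>")
      case True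
      have "ennreal (1 / h powr p) * ?S2 = \<infinity>" using h by (simp add: True ennreal_mult_top)
      then show ?thesis using C by (simp add: ennreal_mult_top)
    next
      case False
      define D where "D = enn2real ?S2"
      have D0: "0 \<le> D" by (simp add: D_def)
      have "x = ennreal (enn2real x)" if "x \<noteq> \<infinity>" for x :: ennreal using that by (cases x) auto
      from this[OF False] have S2: "?S2 = ennreal D" by (simp only: D_def)
      have R2le: "(\<integral>\<^sup>+\<omega>. ennreal (\<bar>R2 n \<omega>\<bar> powr (2 * p)) \<partial>M) \<le> ennreal D" if "n < N" for n
        unfolding S2[symmetric] using that by (intro SUP_upper) auto
      have R2int: "integrable M (\<lambda>\<omega>. \<bar>R2 n \<omega>\<bar> powr (2 * p))" if "n < N" for n
        using that R2le[OF that] by (intro integrableI_nonneg) (auto simp: le_less_trans)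
      have R2D: "expectation (\<lambda>\<omega>. \<bar>R2 n \<omega>\<bar> powr (2 * p)) \<le> D" if "n < N" for n
        using R2le[OF that] R2int[OF that] D0 by (subst (asm) nn_integral_eq_integral) auto
      define b where "b = (\<lambda>\<omega> k. A k \<omega> / (1 + (1 + 2 * K) * h) ^ Suc k)"
      define w where "w = (\<lambda>k \<omega>. b \<omega> k / running_max (b \<omega>) k)"
      \<comment> \<open>\<open>w k\<close> is \<open>F k\<close>-measurable with values in [-1, 1],
        so \<open>d\<close> again consists of martingale differences and inherits the moment bound
        \<open>D\<close> of \<open>R2\<close>.\<close>
      define d where "d = (\<lambda>k \<omega>. w k \<omega> * R2 k \<omega>)"
      have w1: "\<bar>w k \<omega>\<bar> \<le> 1" for k \<omega>
        using abs_le_running_max[of k k "b \<omega>"] running_max_nonneg[of "b \<omega>" k]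
        by (auto simp: w_def abs_divide divide_le_eq_1)
      have bF: "(\<lambda>\<omega>. b \<omega> k) \<in> borel_measurable (F n)" if "k \<le> n" "n < N" for k n
      proof -
        have [measurable]: "A k \<in> borel_measurable (F n)"
          using A subm[of k n] that by (auto intro: measurable_from_subalg)
        show ?thesis unfolding b_def by measurable
      qed
      have wF: "w n \<in> borel_measurable (F n)" if "n < N" for n
      proof -
        have [measurable]: "(\<lambda>\<omega>. running_max (b \<omega>) n) \<in> borel_measurable (F n)"
          using that by (intro borel_measurable_running_max bF) auto
        have [measurable]: "(\<lambda>\<omega>. b \<omega> n) \<in> borel_measurable (F n)" using bF that by simp
        show ?thesis unfolding w_def by measurable
      qed
      have wM: "w n \<in> borel_measurable M" if "n < N" for n
        using wF[OF that] sub[of n] that by (auto intro: measurable_from_subalg)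
      have dle: "\<bar>d n \<omega>\<bar> \<le> \<bar>R2 n \<omega>\<bar>" for n \<omega>
        using mult_right_mono[OF w1, of "\<bar>R2 n \<omega>\<bar>" n \<omega>] by (simp add: d_def abs_mult)
      have dle': "\<bar>d n \<omega>\<bar> powr (2 * p) \<le> \<bar>R2 n \<omega>\<bar> powr (2 * p)" for n \<omega>
        using dle p by (intro powr_mono2) auto
      have dM[measurable]: "d n \<in> borel_measurable M" if "n < N" for n
        unfolding d_def using wM[OF that] R2M[OF that] by measurable
      have dint: "integrable M (\<lambda>\<omega>. \<bar>d n \<omega>\<bar> powr (2 * p))" if "n < N" for n
        using that by (intro Bochner_Integration.integrable_bound[OF R2int[OF that]]) (auto simp: dle')
      have dD: "expectation (\<lambda>\<omega>. \<bar>d n \<omega>\<bar> powr (2 * p)) \<le> D" if "n < N" for n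
        using integral_mono[OF dint[OF that] R2int[OF that] dle'] R2D[OF that] by simp
      have R2int1: "integrable M (R2 n)" if "n < N" for n
      proof (rule Bochner_Integration.integrable_bound)
        show "integrable M (\<lambda>\<omega>. 1 + \<bar>R2 n \<omega>\<bar> powr (2 * p))" using R2int[OF that] by simp
        show "AE \<omega> in M. norm (R2 n \<omega>) \<le> norm (1 + \<bar>R2 n \<omega>\<bar> powr (2 * p))"
        proof (rule AE_I2)
          fix \<omega>
          show "norm (R2 n \<omega>) \<le> norm (1 + \<bar>R2 n \<omega>\<bar> powr (2 * p))"
          proof (cases "\<bar>R2 n \<omega>\<bar> \<le> 1")
            case False
            then have "\<bar>R2 n \<omega>\<bar> powr 1 \<le> \<bar>R2 n \<omega>\<bar> powr (2 * p)" using p by (intro powr_mono) auto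
            then show ?thesis using False by simp
          qed (simp add: add_increasing2)
        qed
      qed (use that in measurable)
      have mdd: "martingale_differences M F N d"
        unfolding martingale_differences_def
      proof (intro conjI allI impI sub subm)
        fix n assume n: "n < N"
        have [measurable]: "w n \<in> borel_measurable (F (Suc n))"
          using wF[OF n] subm[of n "Suc n"] n by (auto intro: measurable_from_subalg)
        show "d n \<in> borel_measurable (F (Suc n))" unfolding d_def using R2F[OF n] by measurable
        have "integrable M (d n)"
          using n by (intro Bochner_Integration.integrable_bound[OF R2int1[OF n]]) (auto simp: dle)
        then show "AE \<omega> in M. real_cond_exp M (F n) (d n) \<omega> = 0"
          unfolding d_def using n by (intro real_cond_exp_mult_eq_0 sub ce wF R2M) auto
      qed
      define m where "m = (\<lambda>\<omega>. running_max (\<lambda>n. \<Sum>k<n. d k \<omega>) N)"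
      have mint: "integrable M (\<lambda>\<omega>. m \<omega> powr (2 * p))"
        and mle: "expectation (\<lambda>\<omega>. m \<omega> powr (2 * p)) \<le> C0 * real N powr p * D"
        using mmm[OF mdd _ _ N, of D] dint dD by (auto simp: m_def)
      have m_nn: "(\<integral>\<^sup>+\<omega>. ennreal (m \<omega> powr (2 * p)) \<partial>M) \<le> ennreal (C0 * real N powr p) * ?S2"
        using mle C0 unfolding S2 by (subst nn_integral_eq_integral[OF mint]) (auto simp: ennreal_mult'[symmetric] ennreal_leI)
      have mmeas[measurable]: "m \<in> borel_measurable M"
        unfolding m_def by (intro borel_measurable_running_max borel_measurable_sum dM) auto

      have Np: "real N powr (p - 1) * real N = real N powr p"
        using powr_mult_base[of "real N" "p - 1"] by (simp add: mult.commute)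
      have sq: "z\<^sup>2 powr p = \<bar>z\<bar> powr (2 * p)" for z :: real
      proof (cases "z = 0")
        case False then show ?thesis using powr_powr[of "\<bar>z\<bar>" 2 p] by (simp add: powr_numeral)
      qed (use p in simp)
      let ?k1 = "3 powr p * c1 powr p"
      \<comment> \<open>The power of \<open>N\<close> comes from the power mean inequality for
        \<open>N\<close> summands, and the division by \<open>h powr p\<close> from the weight
        \<open>1 / h\<close> of the squares of \<open>R1\<close>.\<close>
      let ?k2 = "3 powr p * c2 powr p / h powr p * real N powr (p - 1)"
      let ?k3 = "3 powr p * c2 powr p * real N powr (p - 1)"
      have pw: "AE \<omega> in M. running_max (\<lambda>n. e n \<omega>) N powr (2 * p) \<le> ?k1 * m \<omega> powr (2 * p)
         + ?k2 * (\<Sum>k<N. \<bar>R1 k \<omega>\<bar> powr (2 * p)) + ?k3 * (\<Sum>k<N. \<bar>R2 k \<omega>\<bar> powr (2 * p))"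
        using path
      proof eventually_elim
        fix \<omega> assume *: "e 0 \<omega> = 0 \<and> (\<forall>n<N. \<bar>e (Suc n) \<omega>\<bar> \<le> \<bar>A n \<omega> + R1 n \<omega> + R2 n \<omega>\<bar> \<and>
          (A n \<omega>)\<^sup>2 \<le> (1 + K * h) * (e n \<omega>)\<^sup>2)"
        let ?X = "\<Sum>k<N. (R1 k \<omega>)\<^sup>2" and ?Y = "\<Sum>k<N. (R2 k \<omega>)\<^sup>2"
        have "(running_max (\<lambda>n. e n \<omega>) N)\<^sup>2 \<le> c1 * (m \<omega>)\<^sup>2 + c2 * (?X / h + ?Y)"
          using pathwise_stability[OF h hN K, of "\<lambda>n. e n \<omega>" "\<lambda>n. A n \<omega>" "\<lambda>n. R1 n \<omega>" "\<lambda>n. R2 n \<omega>"] *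
          by (simp add: m_def d_def w_def b_def c1_def c2_def E_def)
        also have "\<dots> = c1 * (m \<omega>)\<^sup>2 + c2 / h * ?X + c2 * ?Y" by (simp add: algebra_simps)
        finally have "((running_max (\<lambda>n. e n \<omega>) N)\<^sup>2) powr p \<le> (c1 * (m \<omega>)\<^sup>2 + c2 / h * ?X + c2 * ?Y) powr p"
          using p by (intro powr_mono2) auto
        also have "\<dots> \<le> 3 powr p * ((c1 * (m \<omega>)\<^sup>2) powr p + (c2 / h * ?X) powr p + (c2 * ?Y) powr p)"
        proof (rule add3_powr_le)
          show "0 \<le> c2 / h * ?X" "0 \<le> c2 * ?Y"
            using c h by (auto intro!: mult_nonneg_nonneg divide_nonneg_nonneg sum_nonneg)
        qed (use p c in auto)
        also have "(c1 * (m \<omega>)\<^sup>2) powr p = c1 powr p * m \<omega> powr (2 * p)"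
          using c by (simp add: powr_mult sq m_def running_max_nonneg)
        also have "(c2 / h * ?X) powr p = c2 powr p / h powr p * ?X powr p"
          using c h by (simp add: powr_mult powr_divide sum_nonneg)
        also have "(c2 * ?Y) powr p = c2 powr p * ?Y powr p"
          using c by (simp add: powr_mult sum_nonneg)
        also have "3 powr p * (c1 powr p * m \<omega> powr (2 * p) + c2 powr p / h powr p * ?X powr p + c2 powr p * ?Y powr p)
          \<le> 3 powr p * (c1 powr p * m \<omega> powr (2 * p)
            + c2 powr p / h powr p * (real N powr (p - 1) * (\<Sum>k<N. (R1 k \<omega>)\<^sup>2 powr p))
            + c2 powr p * (real N powr (p - 1) * (\<Sum>k<N. (R2 k \<omega>)\<^sup>2 powr p)))"
          by (intro mult_left_mono add_mono sum_powr_le p N) auto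
        finally show "running_max (\<lambda>n. e n \<omega>) N powr (2 * p) \<le> ?k1 * m \<omega> powr (2 * p)
         + ?k2 * (\<Sum>k<N. \<bar>R1 k \<omega>\<bar> powr (2 * p)) + ?k3 * (\<Sum>k<N. \<bar>R2 k \<omega>\<bar> powr (2 * p))"
          by (simp add: sq running_max_nonneg algebra_simps)
      qed
      let ?I = "\<lambda>f. \<integral>\<^sup>+\<omega>. f \<omega> \<partial>M"
      have "?L \<le> (\<integral>\<^sup>+\<omega>. ennreal ?k1 * ennreal (m \<omega> powr (2 * p))
         + ennreal ?k2 * (\<Sum>k<N. ennreal (\<bar>R1 k \<omega>\<bar> powr (2 * p)))
         + ennreal ?k3 * (\<Sum>k<N. ennreal (\<bar>R2 k \<omega>\<bar> powr (2 * p))) \<partial>M)"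
        using pw
      proof (intro nn_integral_mono_AE, eventually_elim)
        fix \<omega> assume *: "running_max (\<lambda>n. e n \<omega>) N powr (2 * p) \<le> ?k1 * m \<omega> powr (2 * p)
         + ?k2 * (\<Sum>k<N. \<bar>R1 k \<omega>\<bar> powr (2 * p)) + ?k3 * (\<Sum>k<N. \<bar>R2 k \<omega>\<bar> powr (2 * p))"
        show "ennreal (running_max (\<lambda>n. e n \<omega>) N powr (2 * p)) \<le> ennreal ?k1 * ennreal (m \<omega> powr (2 * p))
         + ennreal ?k2 * (\<Sum>k<N. ennreal (\<bar>R1 k \<omega>\<bar> powr (2 * p)))
         + ennreal ?k3 * (\<Sum>k<N. ennreal (\<bar>R2 k \<omega>\<bar> powr (2 * p)))"
          using ennreal_leI[OF *]
          by (simp add: ennreal_plus[symmetric] ennreal_mult[symmetric] sum_nonneg del: ennreal_plus)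
      qed
      also have "\<dots> = ennreal ?k1 * (\<integral>\<^sup>+\<omega>. ennreal (m \<omega> powr (2 * p)) \<partial>M)
         + ennreal ?k2 * (\<Sum>k<N. \<integral>\<^sup>+\<omega>. ennreal (\<bar>R1 k \<omega>\<bar> powr (2 * p)) \<partial>M)
         + ennreal ?k3 * (\<Sum>k<N. \<integral>\<^sup>+\<omega>. ennreal (\<bar>R2 k \<omega>\<bar> powr (2 * p)) \<partial>M)"
      proof -
        have sums: "(\<integral>\<^sup>+\<omega>. (\<Sum>k<N. ennreal (\<bar>Z k \<omega>\<bar> powr (2 * p))) \<partial>M)
            = (\<Sum>k<N. \<integral>\<^sup>+\<omega>. ennreal (\<bar>Z k \<omega>\<bar> powr (2 * p)) \<partial>M)"
          "(\<lambda>\<omega>. \<Sum>k<N. ennreal (\<bar>Z k \<omega>\<bar> powr (2 * p))) \<in> borel_measurable M"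
          if "\<And>k. k < N \<Longrightarrow> Z k \<in> borel_measurable M" for Z :: "nat \<Rightarrow> 'a \<Rightarrow> real"
          using that by (auto intro!: nn_integral_sum borel_measurable_sum simp del: sum_ennreal)
        note [measurable] = sums(2)[OF R1M] sums(2)[OF R2M]
        show ?thesis
          by (simp add: nn_integral_add nn_integral_cmult sums(1)[OF R1M] sums(1)[OF R2M] del: sum_ennreal)
      qed
      also have "\<dots> \<le> ennreal ?k1 * (ennreal (C0 * real N powr p) * ?S2)
         + ennreal ?k2 * (\<Sum>k<N. ?S1) + ennreal ?k3 * (\<Sum>k<N. ?S2)"
        by (intro add_mono mult_left_mono m_nn sum_mono SUP_upper) auto
      also have "\<dots> = ennreal (?k1 * (C0 * real N powr p)) * ?S2
         + ennreal (?k2 * real N) * ?S1 + ennreal (?k3 * real N) * ?S2"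
      proof -
        have "ennreal a * (ennreal b * S) = ennreal (a * b) * S" if "0 \<le> b" for a b S
          using that by (simp add: ennreal_mult'' mult.assoc)
        moreover have "ennreal a * (\<Sum>k<N. S) = ennreal (a * real N) * S" for a S
          by (simp add: ennreal_mult'' mult.assoc ennreal_of_nat_eq_real_of_nat)
        moreover have "0 \<le> C0 * real N powr p" using C0 by simp
        ultimately show ?thesis by presburger
      qed
      \<comment> \<open>With \<open>N = T / h\<close> each \<open>real N powr p\<close> becomes
        \<open>T powr p / h powr p\<close>. The sum of \<open>R1\<close> carries one more
        \<open>1 / h powr p\<close>, whence the two different rates.\<close>
      also have "?k1 * (C0 * real N powr p) = \<alpha> * (1 / h powr p)"
        using h N by (simp add: \<alpha>_def hN[symmetric] powr_mult)
      also have "?k3 * real N = \<beta> * (1 / h powr p)"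
        using h Np by (simp add: \<beta>_def hN[symmetric] powr_mult)
      also have "?k2 * real N = \<beta> * (1 / h powr (2 * p))"
        using h Np powr_add[of h p p] by (simp add: \<beta>_def hN[symmetric] powr_mult)
      also have "ennreal (\<alpha> * (1 / h powr p)) * ?S2 + ennreal (\<beta> * (1 / h powr (2 * p))) * ?S1
          + ennreal (\<beta> * (1 / h powr p)) * ?S2
        = ennreal \<beta> * (ennreal (1 / h powr (2 * p)) * ?S1) + (ennreal \<alpha> + ennreal \<beta>) * (ennreal (1 / h powr p) * ?S2)"
        using \<alpha>\<beta> by (simp only: ennreal_mult'' divide_nonneg_nonneg zero_le_one powr_ge_zero distrib_right mult.assoc add_ac)
      also have "\<dots> \<le> (ennreal \<alpha> + ennreal \<beta>) * (ennreal (1 / h powr (2 * p)) * ?S1) + (ennreal \<alpha> + ennreal \<beta>) * (ennreal (1 / h powr p) * ?S2)"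
        by (intro add_right_mono mult_right_mono) auto
      also have "\<dots> = ennreal C * (ennreal (1 / h powr (2 * p)) * ?S1 + ennreal (1 / h powr p) * ?S2)"
        unfolding C_def using \<alpha>\<beta> by (simp only: distrib_left ennreal_plus)
      finally show ?thesis .
    qed
  qed
qed

end

section \<open>The implicit scheme\<close>

text \<open>The positive root of \<open>y\<^sup>2 = z * y + k\<close>, an explicit form of the value
  that \<open>scheme\<close> describes by \<open>THE\<close>.\<close>

definition implicit_root :: "real \<Rightarrow> real \<Rightarrow> real" where
  "implicit_root k z = (z + sqrt (z\<^sup>2 + 4 * k)) / 2"

text \<open>Multiplication by \<open>y\<close> turns the equation into a quadratic whose roots have
  product \<open>- k < 0\<close>, so exactly one of them is positive.\<close>

lemma implicit_root_iff:
  assumes k: "0 < k"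
  shows "0 < y \<and> y = z + k * inverse y \<longleftrightarrow> y = implicit_root k z"
proof
  assume y: "0 < y \<and> y = z + k * inverse y"
  then have y0: "0 < y" and yeq: "y = z + k * inverse y" by auto
  have "y * y = (z + k * inverse y) * y" by (rule arg_cong[OF yeq, of "\<lambda>t. t * y"])
  then have "y * y = z * y + k" using y0 by (simp add: distrib_right)
  then have "(2 * y - z)\<^sup>2 = z\<^sup>2 + 4 * k" by (simp add: power2_eq_square algebra_simps)
  moreover have "0 < k * inverse y" using k y0 by simp
  then have "0 \<le> 2 * y - z" using yeq y0 by linarith
  ultimately have "2 * y - z = sqrt (z\<^sup>2 + 4 * k)" by (metis real_sqrt_abs abs_of_nonneg)
  then show "y = implicit_root k z" by (simp add: implicit_root_def)
next
  assume y: "y = implicit_root k z"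
  let ?s = "sqrt (z\<^sup>2 + 4 * k)"
  have "\<bar>z\<bar> < ?s" using k by (intro real_less_rsqrt) simp
  then have y0: "0 < y" by (simp add: y implicit_root_def)
  have "?s\<^sup>2 = z\<^sup>2 + 4 * k" using k by simp
  then have "y * y = z * y + k" by (simp add: y implicit_root_def power2_eq_square field_simps)
  then have "y = z + k * inverse y" using y0 by (simp add: field_simps)
  then show "0 < y \<and> y = z + k * inverse y" using y0 by blast
qed

lemma implicit_root_pos: "0 < k \<Longrightarrow> 0 < implicit_root k z"
  using implicit_root_iff[of k "implicit_root k z" z] by simp

text \<open>Subtracting the equations gives \<open>u - v = (x - y) * (1 + k / (x * y))\<close>, and
  the second factor is at least 1: solving the implicit equation never enlarges a
  difference.\<close>

lemma abs_diff_implicit_le: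
  fixes x y u v k :: real
  assumes "0 \<le> k" "0 < x" "0 < y" "x = u + k * inverse x" "y = v + k * inverse y"
  shows "\<bar>x - y\<bar> \<le> \<bar>u - v\<bar>"
proof -
  have "u - v = (x - y) - k * (inverse x - inverse y)" using assms(4,5) by (simp add: right_diff_distrib)
  also have "inverse x - inverse y = - ((x - y) / (x * y))" using assms(2,3) by (simp add: field_simps)
  finally have "u - v = (x - y) * (1 + k / (x * y))" by (simp add: algebra_simps)
  moreover have "1 \<le> 1 + k / (x * y)" using assms by simp
  ultimately show ?thesis using mult_left_mono[of 1 "1 + k / (x * y)" "\<bar>x - y\<bar>"] by (simp add: abs_mult)
qed

text \<open>The explicit root formula is the source of both positivity and adaptedness of the
  scheme.\<close>

lemma scheme_Suc_root:
  assumes "0 < c * h"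
  shows "scheme \<mu> c \<sigma> W Ph h y0 (Suc n) \<omega> = implicit_root (c * h)
     (Ph (scheme \<mu> c \<sigma> W Ph h y0 n \<omega>) + mu_hat \<mu> c (Ph (scheme \<mu> c \<sigma> W Ph h y0 n \<omega>)) * h
      + \<sigma> * (W (real (Suc n) * h) \<omega> - W (real n * h) \<omega>))"
    (is "_ = implicit_root _ (?u + ?v + ?w)")
proof -
  have "0 < y \<and> y = ?u + c * h * inverse y + ?v + ?w \<longleftrightarrow> y = implicit_root (c * h) (?u + ?v + ?w)" for y
    unfolding implicit_root_iff[OF assms, symmetric] by (simp add: add_ac)
  then show ?thesis by simp
qed

lemma scheme_pos: "0 < c * h \<Longrightarrow> 0 < y0 \<Longrightarrow> 0 < scheme \<mu> c \<sigma> W Ph h y0 n \<omega>"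
  by (cases n) (simp_all only: scheme.simps(1) scheme_Suc_root implicit_root_pos)

section \<open>Regularity of the Lamperti transformation and the one-step estimate\<close>

lemma lamperti_continuous_on:
  assumes g: "continuous_on {0<..} g" and g_pos: "\<forall>x>0. 0 < g x" and a: "0 < a"
  shows "continuous_on {0<..} (lamperti a b \<sigma> g)"
proof (intro continuous_at_imp_continuous_on ballI)
  fix x :: real assume "x \<in> {0<..}"
  then have x: "0 < x" by simp
  \<comment> \<open>A compact interval inside the positive half-line with both \<open>a\<close> and
    \<open>x\<close> in its interior, so that the derivative within the interval is a two-sided
    derivative at \<open>x\<close>.\<close>
  define l u where "l = min a x / 2" and "u = max a x + 1"
  have lu: "0 < l" "l < a" "a < u" "l < x" "x < u" using a x by (auto simp: l_def u_def)
  have "\<forall>y\<in>{l..u}. g y \<noteq> 0"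
  proof
    fix y assume "y \<in> {l..u}"
    then have "0 < g y" using lu g_pos by simp
    then show "g y \<noteq> 0" by simp
  qed
  then have "continuous_on {l..u} (\<lambda>y. 1 / g y)"
    using lu by (intro continuous_intros continuous_on_subset[OF g]) auto
  then have "((\<lambda>y. LBINT z=a..y. 1 / g z) has_vector_derivative (1 / g x)) (at x within {l..u})"
    using lu by (intro interval_integral_FTC2) auto
  then have "((\<lambda>y. LBINT z=a..y. 1 / g z) has_vector_derivative (1 / g x)) (at x)"
    using lu by (simp add: at_within_Icc_at)
  then have "isCont (\<lambda>y::real. LBINT z=a..y. 1 / g z) x" by (rule has_vector_derivative_continuous)
  then show "isCont (lamperti a b \<sigma> g) x"
    unfolding lamperti_def[abs_def] by (intro continuous_intros)
qed

text \<open>When the square is expanded, one-sided monotonicity bounds the cross term by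
  \<open>2 * L * h\<close>. The Lipschitz constant of order \<open>h powr (- 1 / 2)\<close>, squared
  and multiplied by \<open>h\<^sup>2\<close>, contributes only \<open>C\<^sup>2 * h\<close>.\<close>

lemma one_step_square_le:
  fixes x y x' y' u v h L C :: real
  assumes h: "0 < h" and L: "0 \<le> L" and D: "\<bar>x' - y'\<bar> \<le> \<bar>x - y\<bar>" and os: "(u - v) * (x' - y') \<le> L * \<bar>x' - y'\<bar>\<^sup>2"
    and lip: "\<bar>u - v\<bar> \<le> C * h powr (- 1 / 2) * \<bar>x - y\<bar>"
  shows "((x' + u * h) - (y' + v * h))\<^sup>2 \<le> (1 + (2 * L + C\<^sup>2) * h) * (x - y)\<^sup>2"
proof -
  have D2: "(x' - y')\<^sup>2 \<le> (x - y)\<^sup>2" using D by (simp add: abs_le_square_iff)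
  have "(u - v)\<^sup>2 \<le> (C * h powr (- 1 / 2) * \<bar>x - y\<bar>)\<^sup>2"
    using power_mono[OF lip, of 2] by simp
  also have "\<dots> = C\<^sup>2 * (h powr (- 1 / 2))\<^sup>2 * (x - y)\<^sup>2" by (simp add: power_mult_distrib)
  also have "(h powr (- 1 / 2))\<^sup>2 = 1 / h"
    using h powr_powr[of h "- 1 / 2" 2] by (simp add: powr_numeral powr_minus_divide)
  finally have "h\<^sup>2 * (u - v)\<^sup>2 \<le> h\<^sup>2 * (C\<^sup>2 * (1 / h) * (x - y)\<^sup>2)" by (intro mult_left_mono) auto
  also have "\<dots> = C\<^sup>2 * h * (x - y)\<^sup>2" using h by (simp add: power2_eq_square)
  finally have 1: "h\<^sup>2 * (u - v)\<^sup>2 \<le> C\<^sup>2 * h * (x - y)\<^sup>2" .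
  have "(u - v) * (x' - y') \<le> L * (x' - y')\<^sup>2" using os by simp
  also have "\<dots> \<le> L * (x - y)\<^sup>2" using D2 L by (intro mult_left_mono)
  finally have "2 * h * ((u - v) * (x' - y')) \<le> 2 * h * (L * (x - y)\<^sup>2)" using h by (intro mult_left_mono) auto
  moreover have "((x' + u * h) - (y' + v * h))\<^sup>2 = (x' - y')\<^sup>2 + 2 * h * ((u - v) * (x' - y')) + h\<^sup>2 * (u - v)\<^sup>2"
    by (simp add: power2_eq_square algebra_simps)
  ultimately show ?thesis using 1 D2 by (simp add: algebra_simps)
qed

lemma continuous_on_Lipschitz_real:
  fixes f :: "real \<Rightarrow> real"
  assumes "\<And>x y. x \<in> S \<Longrightarrow> y \<in> S \<Longrightarrow> \<bar>f x - f y\<bar> \<le> B * \<bar>x - y\<bar>" and "0 \<le> B"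
  shows "continuous_on S f"
  using assms by (intro lipschitz_on_continuous_on[of B] lipschitz_onI) (auto simp: dist_real_def)

lemma usual_filtration_subalgebra:
  assumes "usual_filtration M F"
  shows "0 \<le> t \<Longrightarrow> subalgebra M (F t)" "0 \<le> s \<Longrightarrow> s \<le> t \<Longrightarrow> subalgebra (F t) (F s)"
proof -
  have sub: "\<forall>t\<ge>0. subalgebra M (F t)"
    using assms unfolding usual_filtration_def by (elim conjE)
  then show "0 \<le> t \<Longrightarrow> subalgebra M (F t)" by simp
  have "\<forall>s t. 0 \<le> s \<longrightarrow> s \<le> t \<longrightarrow> sets (F s) \<subseteq> sets (F t)"
    using assms unfolding usual_filtration_def by (elim conjE)
  then show "0 \<le> s \<Longrightarrow> s \<le> t \<Longrightarrow> subalgebra (F t) (F s)"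
    using sub by (simp add: subalgebra_def)
qed

section \<open>The error estimate for the scheme\<close>

theorem theorem4p2:
  fixes M :: "'a measure" and F :: "real \<Rightarrow> 'a measure"
    and W X\<^sub>o X :: "real \<Rightarrow> 'a \<Rightarrow> real"
    and f g \<mu> :: "real \<Rightarrow> real"
    and T a b \<sigma> x\<^sub>0 c m\<^sub>1 m\<^sub>2 p :: real and pstar :: ereal
    and P :: "real \<Rightarrow> real \<Rightarrow> real"
    and R1 R2 :: "nat \<Rightarrow> nat \<Rightarrow> 'a \<Rightarrow> real"
  assumes T: "0 < T"
    and filtration: "usual_filtration M F"
    and brownian: "brownian_motion M F W"
    \<comment> \<open>coefficients of the original equation and the Lamperti transformation\<close>
    and f_C1: "f C1_differentiable_on {0<..}"
    and g_C1: "g C1_differentiable_on {0<..}"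
    and g_pos: "\<forall>x>0. 0 < g x"
    and x0_pos: "0 < x\<^sub>0"
    and a_pos: "0 < a" and sigma_nz: "\<sigma> \<noteq> 0"
    and lamperti_bij: "bij_betw (lamperti a b \<sigma> g) {0<..} {0<..}"
    and X_def: "\<forall>t\<ge>0. \<forall>\<omega>. X t \<omega> = lamperti a b \<sigma> g (X\<^sub>o t \<omega>)"
    and mu_def: "\<forall>x>0. \<mu> x = lamperti_drift a b \<sigma> f g x"
    \<comment> \<open>the transformed equation, in integrated form\<close>
    and X_sde: "AE \<omega> in M. \<forall>t\<ge>0.
        X t \<omega> = lamperti a b \<sigma> g x\<^sub>0 + (LBINT u=0..t. \<mu> (X u \<omega>)) + \<sigma> * W t \<omega>"
    and mu_FLP: "is_FLP \<mu>"
    \<comment> \<open>the data of the scheme\<close>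
    and c_pos: "0 < c"
    and P_pos: "\<forall>h\<in>step_sizes T. \<forall>x>0. 0 < P h x"
    and decomposition: "\<forall>N\<in>admissible_steps T.
        remainder_decomposition M F (remainder \<mu> c X (P (T / real N)) (T / real N))
          (T / real N) N (R1 N) (R2 N)"
    \<comment> \<open>the assumptions (A1) to (A6)\<close>
    and A1: "unique_strong_solution M F W f g x\<^sub>0 X\<^sub>o"
    and A2: "\<mu> C1_differentiable_on {0<..}"
            "\<exists>L\<^sub>0>0. \<forall>x>0. \<forall>y>0. (\<mu> x - \<mu> y) * (x - y) \<le> L\<^sub>0 * \<bar>x - y\<bar>\<^sup>2"
    and A3: "2 < pstar"
            "\<forall>q>0. ereal q \<le> pstar \<longrightarrow>
               (SUP t\<in>{0..T}. \<integral>\<^sup>+\<omega>. ennreal (\<bar>X t \<omega>\<bar> powr (- q)) \<partial>M) < \<infinity>"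
    and A4: "\<exists>L>0. \<forall>x>0. \<forall>y>0.
               (mu_hat \<mu> c x - mu_hat \<mu> c y) * (x - y) \<le> L * \<bar>x - y\<bar>\<^sup>2"
    and A5: "\<forall>h\<in>step_sizes T. \<forall>x>0. \<forall>y>0. \<bar>P h x - P h y\<bar> \<le> \<bar>x - y\<bar>"
            "0 \<le> m\<^sub>1" "0 \<le> m\<^sub>2"
            "\<exists>C>0. \<forall>h\<in>step_sizes T. \<forall>x>0.
               \<bar>P h x - x\<bar> \<le> C * h\<^sup>2 * (1 + \<bar>x\<bar> powr (- m\<^sub>1) + \<bar>x\<bar> powr m\<^sub>2)"
    and A6: "\<exists>C>0. \<forall>h\<in>step_sizes T. \<forall>x>0. \<forall>y>0.
               \<bar>mu_hat \<mu> c (P h x)\<bar> \<le> max (C * h powr (- 1 / 2)) (C * \<bar>x\<bar>) \<and>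
               \<bar>mu_hat \<mu> c (P h x) - mu_hat \<mu> c (P h y)\<bar> \<le> C * h powr (- 1 / 2) * \<bar>x - y\<bar>"
    and p: "1 \<le> p" "ereal p \<le> exponent_bound pstar (deg_minus \<mu>) m\<^sub>1"
  shows "\<exists>C>0. \<forall>N\<in>admissible_steps T. let h = T / real N in
    (\<integral>\<^sup>+\<omega>. (SUP n\<in>{0..N}. ennreal (\<bar>X (real n * h) \<omega>
               - scheme \<mu> c \<sigma> W (P h) h (lamperti a b \<sigma> g x\<^sub>0) n \<omega>\<bar> powr (2 * p))) \<partial>M)
    \<le> ennreal C *
       (ennreal (1 / h powr (2 * p)) * (SUP n\<in>{1..N}. \<integral>\<^sup>+\<omega>. ennreal (\<bar>R1 N n \<omega>\<bar> powr (2 * p)) \<partial>M)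
        + ennreal (1 / h powr p) * (SUP n\<in>{1..N}. \<integral>\<^sup>+\<omega>. ennreal (\<bar>R2 N n \<omega>\<bar> powr (2 * p)) \<partial>M))"
proof -
  interpret prob_space M using filtration by (simp only: usual_filtration_def)
  let ?X0 = "lamperti a b \<sigma> g x\<^sub>0"
  obtain L where L: "0 < L" "\<And>x y. 0 < x \<Longrightarrow> 0 < y \<Longrightarrow>
      (mu_hat \<mu> c x - mu_hat \<mu> c y) * (x - y) \<le> L * \<bar>x - y\<bar>\<^sup>2"
    using A4 by blast
  obtain C6 where C6: "0 < C6" "\<And>h x y. h \<in> step_sizes T \<Longrightarrow> 0 < x \<Longrightarrow> 0 < y \<Longrightarrow>
      \<bar>mu_hat \<mu> c (P h x) - mu_hat \<mu> c (P h y)\<bar> \<le> C6 * h powr (- 1 / 2) * \<bar>x - y\<bar>"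
    using A6 by blast
  \<comment> \<open>The growth constant of the one-step estimate; \<open>L\<close> and
    \<open>C6\<close> are chosen before the step size, hence so are \<open>K\<close> and the final
    \<open>C\<close>.\<close>
  define K where "K = 2 * L + C6\<^sup>2"
  have K: "0 \<le> K" using L by (simp add: K_def)
  from stability_moment[OF p(1) K T] obtain C where C: "0 < C" and stab:
    "\<forall>F N h e A R1 R2.
    0 < h \<longrightarrow> h \<le> 1 \<longrightarrow> 1 \<le> N \<longrightarrow> h * real N = T \<longrightarrow> martingale_differences M F N R2 \<longrightarrow>
    (\<forall>n<N. A n \<in> borel_measurable (F n)) \<longrightarrow> (\<forall>n<N. R1 n \<in> borel_measurable M) \<longrightarrow>
    (AE \<omega> in M. e 0 \<omega> = 0 \<and> (\<forall>n<N. \<bar>e (Suc n) \<omega>\<bar> \<le> \<bar>A n \<omega> + R1 n \<omega> + R2 n \<omega>\<bar> \<and>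
        (A n \<omega>)\<^sup>2 \<le> (1 + K * h) * (e n \<omega>)\<^sup>2)) \<longrightarrow>
    (\<integral>\<^sup>+\<omega>. ennreal (running_max (\<lambda>n. e n \<omega>) N powr (2 * p)) \<partial>M) \<le> ennreal C *
       (ennreal (1 / h powr (2 * p)) * (SUP n\<in>{..<N}. \<integral>\<^sup>+\<omega>. ennreal (\<bar>R1 n \<omega>\<bar> powr (2 * p)) \<partial>M)
        + ennreal (1 / h powr p) * (SUP n\<in>{..<N}. \<integral>\<^sup>+\<omega>. ennreal (\<bar>R2 n \<omega>\<bar> powr (2 * p)) \<partial>M))"
    by (elim exE conjE) (rule that)
  note subF = usual_filtration_subalgebra(1)[OF filtration] and subFF = usual_filtration_subalgebra(2)[OF filtration]
  have W_meas: "W t \<in> borel_measurable (F t)" if "0 \<le> t" for t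
    using brownian that by (simp add: brownian_motion_def adapted_def)
  have sol: "strong_solution M F W f g x\<^sub>0 X\<^sub>o" using A1 by (simp add: unique_strong_solution_def)
  have Xo_meas: "X\<^sub>o t \<in> borel_measurable (F t)" if "0 \<le> t" for t
    using sol that by (simp add: strong_solution_def adapted_def)
  have lam_pos: "0 < lamperti a b \<sigma> g x" if "0 < x" for x
    using lamperti_bij that by (auto simp: bij_betw_def)
  have lam_cont: "continuous_on {0<..} (lamperti a b \<sigma> g)"
    by (intro lamperti_continuous_on C1_differentiable_imp_continuous_on g_C1 g_pos a_pos)
  have mu_cont: "continuous_on {0<..} \<mu>" by (intro C1_differentiable_imp_continuous_on A2)
  have y0: "0 < ?X0" by (rule lam_pos[OF x0_pos])
  have X_path: "AE \<omega> in M. continuous_on {0..} (\<lambda>t. X t \<omega>) \<and> (\<forall>t\<ge>0. 0 < X\<^sub>o t \<omega> \<and> 0 < X t \<omega>) \<and> X 0 \<omega> = ?X0"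
  proof -
    have "AE \<omega> in M. continuous_on {0..} (\<lambda>t. X\<^sub>o t \<omega>)" "AE \<omega> in M. \<forall>t\<ge>0. 0 < X\<^sub>o t \<omega>"
      "AE \<omega> in M. X\<^sub>o 0 \<omega> = x\<^sub>0"
      using sol by (auto simp: strong_solution_def)
    then show ?thesis
    proof eventually_elim
      case (elim \<omega>)
      have "continuous_on {0..} (\<lambda>t. lamperti a b \<sigma> g (X\<^sub>o t \<omega>))"
        by (rule continuous_on_compose2[OF lam_cont elim(1)]) (use elim(2) in auto)
      then have "continuous_on {0..} (\<lambda>t. X t \<omega>)"
        by (rule continuous_on_eq) (simp add: X_def)
      then show ?case using elim X_def lam_pos by simp
    qed
  qed
  show ?thesis
  proof (intro exI[of _ C] conjI C ballI)
    fix N assume N: "N \<in> admissible_steps T"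
    define h where "h = T / real N"
    have N1: "1 \<le> N" and h1: "h \<le> 1" using N by (auto simp: admissible_steps_def h_def)
    have h0: "0 < h" and hN: "h * real N = T" using N1 T by (auto simp: h_def)
    have hs: "h \<in> step_sizes T" using N by (auto simp: step_sizes_def h_def)
    have ch: "0 < c * h" using c_pos h0 by simp
    have Pp: "0 < P h x" if "0 < x" for x using P_pos hs that by blast
    have dec: "remainder_decomposition M F (remainder \<mu> c X (P h) h) h N (R1 N) (R2 N)"
      using decomposition N by (simp add: h_def)
    define Y where "Y = scheme \<mu> c \<sigma> W (P h) h ?X0"
    have Ypos: "0 < Y n \<omega>" for n \<omega> unfolding Y_def by (rule scheme_pos[OF ch y0])
    \<comment> \<open>The explicit part of a step without noise. The extension by 0 makes it Borel
      on the whole line; on the positive half-line it is continuous because (A5) and (A6) are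
      Lipschitz bounds for fixed \<open>h\<close>.\<close>
    define \<Phi> where "\<Phi> = (\<lambda>x. if x \<in> {0<..} then P h x + mu_hat \<mu> c (P h x) * h else 0)"
    have \<Phi>_meas[measurable]: "\<Phi> \<in> borel_measurable borel"
      unfolding \<Phi>_def
    proof (intro borel_measurable_continuous_on_if continuous_intros)
      show "continuous_on {0<..} (P h)"
        using A5(1) hs by (intro continuous_on_Lipschitz_real[where B=1]) auto
      show "continuous_on {0<..} (\<lambda>x. mu_hat \<mu> c (P h x))"
        using C6 hs by (intro continuous_on_Lipschitz_real[where B="C6 * h powr (- 1 / 2)"]) auto
    qed auto
    have \<Phi>_le: "(\<Phi> x - \<Phi> y)\<^sup>2 \<le> (1 + K * h) * (x - y)\<^sup>2" if "0 < x" "0 < y" for x y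
      unfolding \<Phi>_def K_def using that h0 L Pp C6(2)[OF hs] A5(1) hs
      by (simp, intro one_step_square_le) auto
    have nh: "0 \<le> real n * h" for n using h0 by simp
    have nhm: "real m * h \<le> real n * h" if "m \<le> n" for m n using h0 that by simp
    have Y_meas: "Y n \<in> borel_measurable (F (real n * h))" for n
    proof (induction n)
      case 0 then show ?case by (simp add: Y_def)
    next
      case (Suc n)
      let ?G = "F (real (Suc n) * h)"
      have [measurable]: "Y n \<in> borel_measurable ?G" "W (real n * h) \<in> borel_measurable ?G"
        "W (real (Suc n) * h) \<in> borel_measurable ?G"
        using measurable_from_subalg[OF subFF[OF nh nhm[of n "Suc n"]]] Suc W_meas[OF nh[of n]] W_meas[OF nh[of "Suc n"]]
        by (auto simp del: of_nat_Suc)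
      \<comment> \<open>The scheme is positive at every \<open>\<omega>\<close>, so the default
        branch of \<open>\<Phi>\<close> is never taken along \<open>Y\<close>.\<close>
      have YS: "Y (Suc n) = (\<lambda>\<omega>. implicit_root (c * h) (\<Phi> (Y n \<omega>)
          + \<sigma> * (W (real (Suc n) * h) \<omega> - W (real n * h) \<omega>)))"
        using Ypos[of n] by (auto simp only: Y_def scheme_Suc_root[OF ch] \<Phi>_def greaterThan_iff if_True)
      show ?case unfolding YS implicit_root_def by measurable
    qed
    \<comment> \<open>\<open>lamperti\<close> is junk outside \<open>(0,\<infinity>)\<close>, so \<open>X\<close> itself need not be adapted; it agrees almost surely
      with the adapted process \<open>lam (X\<^sub>o t)\<close>.\<close>
    define lam where "lam = (\<lambda>x. if x \<in> {0<..} then lamperti a b \<sigma> g x else 1)"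
    have [measurable]: "lam \<in> borel_measurable borel"
      unfolding lam_def by (intro borel_measurable_continuous_on_if lam_cont continuous_intros) auto
    define A where "A = (\<lambda>n \<omega>. \<Phi> (lam (X\<^sub>o (real n * h) \<omega>)) - \<Phi> (Y n \<omega>))"
    have A_meas: "A n \<in> borel_measurable (F (real n * h))" for n
    proof -
      have [measurable]: "Y n \<in> borel_measurable (F (real n * h))" "X\<^sub>o (real n * h) \<in> borel_measurable (F (real n * h))"
        by (rule Y_meas, rule Xo_meas[OF nh])
      show ?thesis unfolding A_def by measurable
    qed
    define e where "e = (\<lambda>n \<omega>. X (real n * h) \<omega> - Y n \<omega>)"
    \<comment> \<open>The part \<open>R2 N (Suc n)\<close> belongs to the step from
      \<open>n * h\<close> to \<open>(n + 1) * h\<close> and thus is the increment with index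
      \<open>n\<close>.\<close>
    have md: "martingale_differences M (\<lambda>n. F (real n * h)) N (\<lambda>n. R2 N (Suc n))"
      unfolding martingale_differences_def using dec subF nh subFF nhm
      by (auto simp: remainder_decomposition_def)
    have R1_meas: "\<forall>n<N. R1 N (Suc n) \<in> borel_measurable M"
      using dec measurable_from_subalg[OF subF[OF nh]]
      unfolding remainder_decomposition_def by blast
    have "AE \<omega> in M. \<forall>n\<in>{..<N}. remainder \<mu> c X (P h) h n \<omega> = R1 N (Suc n) \<omega> + R2 N (Suc n) \<omega>"
      using dec by (intro AE_finite_allI) (auto simp: remainder_decomposition_def)
    with X_path X_sde have path: "AE \<omega> in M. e 0 \<omega> = 0 \<and> (\<forall>n<N. \<bar>e (Suc n) \<omega>\<bar> \<le> \<bar>A n \<omega> + R1 N (Suc n) \<omega> + R2 N (Suc n) \<omega>\<bar> \<and>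
        (A n \<omega>)\<^sup>2 \<le> (1 + K * h) * (e n \<omega>)\<^sup>2)"
    proof eventually_elim
      case (elim \<omega>)
      have Xpos: "0 < X t \<omega>" if "0 \<le> t" for t using elim that by simp
      have lamX: "lam (X\<^sub>o t \<omega>) = X t \<omega>" if "0 \<le> t" for t
        using elim that X_def by (simp add: lam_def)
      have muX: "continuous_on {0..} (\<lambda>t. \<mu> (X t \<omega>))"
        by (rule continuous_on_compose2[OF mu_cont conjunct1[OF elim(1)]]) (use Xpos in auto)
      show ?case
      proof (intro conjI allI impI)
        show "e 0 \<omega> = 0" using elim by (simp add: e_def Y_def)
        fix n assume n: "n < N"
        let ?s = "real n * h" and ?t = "real (Suc n) * h"
        have st: "0 \<le> ?s" "?s \<le> ?t" "0 \<le> ?t" using nh[of n] nh[of "Suc n"] nhm[of n "Suc n"] by (auto simp del: of_nat_Suc)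
        have Aeq: "A n \<omega> = \<Phi> (X ?s \<omega>) - \<Phi> (Y n \<omega>)" by (simp add: A_def lamX[OF st(1)])
        show "(A n \<omega>)\<^sup>2 \<le> (1 + K * h) * (e n \<omega>)\<^sup>2"
          unfolding Aeq e_def by (rule \<Phi>_le[OF Xpos[OF st(1)] Ypos])
        \<comment> \<open>Continuity of the path makes the drift integrable on compact intervals.
          Additivity of the integral depends on this, because a non-integrable function has the
          default integral 0.\<close>
        have "interval_lebesgue_integrable lborel (ereal 0) (ereal ?t) (\<lambda>u. \<mu> (X u \<omega>))"
          using st by (intro interval_integrable_continuous_on continuous_on_subset[OF muX]) auto
        then have "(LBINT u=ereal 0..ereal ?s. \<mu> (X u \<omega>)) + (LBINT u=ereal ?s..ereal ?t. \<mu> (X u \<omega>))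
          = (LBINT u=ereal 0..ereal ?t. \<mu> (X u \<omega>))"
          using st by (intro interval_integral_sum) (simp add: min_def max_def)
        then have int: "(LBINT u=0..ereal ?t. \<mu> (X u \<omega>)) = (LBINT u=0..ereal ?s. \<mu> (X u \<omega>)) + (LBINT u=ereal ?s..ereal ?t. \<mu> (X u \<omega>))"
          by (simp add: zero_ereal_def)
        let ?dW = "\<sigma> * (W ?t \<omega> - W ?s \<omega>)" and ?R = "R1 N (Suc n) \<omega> + R2 N (Suc n) \<omega>"
        have R: "remainder \<mu> c X (P h) h n \<omega> = ?R" using elim n by simp
        have Xt: "X ?t \<omega> = ?X0 + (LBINT u=0..ereal ?t. \<mu> (X u \<omega>)) + \<sigma> * W ?t \<omega>"
          and Xs: "X ?s \<omega> = ?X0 + (LBINT u=0..ereal ?s. \<mu> (X u \<omega>)) + \<sigma> * W ?s \<omega>"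
          using elim(2) st by blast+
        have "X ?t \<omega> = X ?s \<omega> + (LBINT u=ereal ?s..ereal ?t. \<mu> (X u \<omega>)) + ?dW"
          using Xt Xs int by (simp add: algebra_simps del: of_nat_Suc)
        \<comment> \<open>The remainder is defined so that \<open>X\<close> solves the implicit
          equation of the scheme with the additional input \<open>?R\<close>.\<close>
        also have "\<dots> = \<Phi> (X ?s \<omega>) + ?dW + ?R + c * h * inverse (X ?t \<omega>)"
          using Xpos[OF st(1)] by (simp add: R[symmetric] remainder_def \<Phi>_def del: of_nat_Suc)
        finally have Xeq: "X ?t \<omega> = (\<Phi> (X ?s \<omega>) + ?dW + ?R) + c * h * inverse (X ?t \<omega>)" .
        have Yeq: "Y (Suc n) \<omega> = (\<Phi> (Y n \<omega>) + ?dW) + c * h * inverse (Y (Suc n) \<omega>)"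
        proof -
          have "Y (Suc n) \<omega> = implicit_root (c * h) (\<Phi> (Y n \<omega>) + ?dW)"
            using Ypos[of n \<omega>] by (simp only: Y_def scheme_Suc_root[OF ch] \<Phi>_def greaterThan_iff if_True)
          then show ?thesis using implicit_root_iff[OF ch] by blast
        qed
        \<comment> \<open>Both equations contain the same Brownian increment, which cancels in the
          difference of the explicit parts.\<close>
        have "\<bar>X ?t \<omega> - Y (Suc n) \<omega>\<bar> \<le> \<bar>(\<Phi> (X ?s \<omega>) + ?dW + ?R) - (\<Phi> (Y n \<omega>) + ?dW)\<bar>"
          using ch by (intro abs_diff_implicit_le[OF _ Xpos[OF st(3)] Ypos Xeq Yeq]) simp
        then show "\<bar>e (Suc n) \<omega>\<bar> \<le> \<bar>A n \<omega> + R1 N (Suc n) \<omega> + R2 N (Suc n) \<omega>\<bar>"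
          unfolding e_def Aeq by (simp add: algebra_simps del: of_nat_Suc)
      qed
    qed
    \<comment> \<open>The theorem numbers the remainders from 1 to \<open>N\<close>, the stability
      lemma from 0 to \<open>N - 1\<close>.\<close>
    have sup: "(SUP n\<in>{1..N}. \<phi> n) = (SUP n\<in>{..<N}. \<phi> (Suc n))" for \<phi> :: "nat \<Rightarrow> ennreal"
    proof -
      have "{1..N} = Suc ` {..<N}" by (simp add: image_Suc_lessThan)
      then show ?thesis by (simp only: image_image)
    qed
    have "(\<integral>\<^sup>+\<omega>. (SUP n\<in>{0..N}. ennreal (\<bar>e n \<omega>\<bar> powr (2 * p))) \<partial>M)
        \<le> (\<integral>\<^sup>+\<omega>. ennreal (running_max (\<lambda>n. e n \<omega>) N powr (2 * p)) \<partial>M)"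
      using p(1) by (intro nn_integral_mono SUP_least ennreal_leI powr_mono2 abs_le_running_max) auto
    also have "\<dots> \<le> ennreal C *
       (ennreal (1 / h powr (2 * p)) * (SUP n\<in>{..<N}. \<integral>\<^sup>+\<omega>. ennreal (\<bar>R1 N (Suc n) \<omega>\<bar> powr (2 * p)) \<partial>M)
        + ennreal (1 / h powr p) * (SUP n\<in>{..<N}. \<integral>\<^sup>+\<omega>. ennreal (\<bar>R2 N (Suc n) \<omega>\<bar> powr (2 * p)) \<partial>M))"
      by (rule stab[rule_format, OF h0 h1 N1 hN md _ _ path]) (use A_meas R1_meas in auto)
    finally show "let h = T / real N in
      (\<integral>\<^sup>+\<omega>. (SUP n\<in>{0..N}. ennreal (\<bar>X (real n * h) \<omega>
               - scheme \<mu> c \<sigma> W (P h) h (lamperti a b \<sigma> g x\<^sub>0) n \<omega>\<bar> powr (2 * p))) \<partial>M)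
    \<le> ennreal C *
       (ennreal (1 / h powr (2 * p)) * (SUP n\<in>{1..N}. \<integral>\<^sup>+\<omega>. ennreal (\<bar>R1 N n \<omega>\<bar> powr (2 * p)) \<partial>M)
        + ennreal (1 / h powr p) * (SUP n\<in>{1..N}. \<integral>\<^sup>+\<omega>. ennreal (\<bar>R2 N n \<omega>\<bar> powr (2 * p)) \<partial>M))"
      unfolding Let_def h_def[symmetric] sup e_def Y_def by simp
  qed
qed

end
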